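(* Let $d\ge3$ and let $G$ be a bipartite graph with bipartition $(U,W)$ such that $$\sum_{v\in N(u)}\frac{1}{d-\deg(v)}\le 1\qquad\text{for all } u\in U.$$ Then $t(G,d)$ is finite.
   Context: Graphs are finite and simple; $N(u)$ is the neighborhood and $\deg(v)$ the degree. $G=(V,E)$ is $d$-sparse if it has no subgraph isomorphic to $K_{a,b}$ with $a,b\ge1$, $a+b>d$ (the hypothesis implies $G$ is $d$-sparse). $S^{d-1}$ is the unit sphere of $\mathbb{R}^d$, $A_k$ the surface area of $S^k\subset\mathbb{R}^{k+1}$, and $\mathrm{Det}(y_1,\dots,y_m)=\sqrt{\det((y_i^{\top}y_j)_{i,j})}$ ($=1$ for the empty family). For an ordering (bijection) $p:V\to\{1,\dots,|V|\}$ let $N_p(v)=\{w:vw\in E,\ p(w)<p(v)\}$, $d_p(v)=|N_p(v)|$, $x_p(v)=(x_w:w\in N_p(v))$. Let $\rho_p$ be the distribution on $(S^{d-1})^V$ of the random sequential ortho-homomorphism: process nodes in increasing $p$, choosing $x_v$ uniformly from the sphere $\{y\in S^{d-1}: y\perp x_w\ \forall w\in N_p(v)\}$. The ortho-homomorphism density is $$t(G,d)=\int \frac{A_{d-1}^{|E|-|V|}}{A_{d-2}^{|E|}}\prod_{v\in V}\frac{A_{d-d_p(v)-1}}{\mathrm{Det}(x_p(v))}\,d\rho_p(x)\in(0,\infty],$$ which does not depend on $p$. (For bipartite $G$ with classes $U,W$ this equals $\frac{A_{d-1}^{|E|-|W|}}{A_{d-2}^{|E|}}\int_{(S^{d-1})^U}\prod_{v\in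 W}\frac{A_{d-\deg(v)-1}}{\mathrm{Det}(x(N(v)))}\,d\pi^U(x)$, $\pi$ the uniform probability measure on $S^{d-1}$.) *)

theory Defs
  imports "HOL-Analysis.Analysis"
begin

text \<open>Finite simple graphs: vertex set V, edge set E of 2-element subsets of V.\<close>

definition nbhd :: "'v set set \<Rightarrow> 'v \<Rightarrow> 'v set" where
  "nbhd E u = {w. {u, w} \<in> E}"

definition degree :: "'v set set \<Rightarrow> 'v \<Rightarrow> nat" where
  "degree E u = card (nbhd E u)"

definition Np :: "'v set set \<Rightarrow> ('v \<Rightarrow> nat) \<Rightarrow> 'v \<Rightarrow> 'v set" where
  "Np E p v = {w \<in> nbhd E v. p w < p v}"

text \<open>Surface area A_k of the unit sphere S^k in R^(k+1).\<close>
definition sphere_area :: "nat \<Rightarrow> real" where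
  "sphere_area k = 2 * pi powr ((real k + 1) / 2) / Gamma ((real k + 1) / 2)"

text \<open>Gram determinant Det(y_i : i in S) = sqrt(det(y_i . y_j)); equals 1 for S empty.\<close>
definition gram_Det :: "'i set \<Rightarrow> ('i \<Rightarrow> 'a::real_inner) \<Rightarrow> real" where
  "gram_Det S y = sqrt (\<Sum>\<pi> | \<pi> permutes S. of_int (sign \<pi>) * (\<Prod>i\<in>S. y i \<bullet> y (\<pi> i)))"

text \<open>Uniform probability measure on S^(d-1) (d = CARD('d)): the normalized (cone) image of the
  uniform distribution on the unit ball.\<close>
definition unif_sphere :: "(real^'d) measure" where
  "unif_sphere = distr (uniform_measure lborel (ball 0 1)) borel sgn"

definition orth_proj :: "(real^'d) set \<Rightarrow> real^'d \<Rightarrow> real^'d" where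
  "orth_proj X y = closest_point {z. \<forall>w\<in>X. z \<bullet> w = 0} y"

text \<open>Random sequential ortho-homomorphism, driven by independent uniform points y_v on S^(d-1):
  the node at position k (in the order p) receives x_v = sgn(P_L y_v), where L is the
  orthogonal complement of the already chosen vectors x_w, w in N_p(v).  Since the image of the
  uniform measure on S^(d-1) under y |-> P_L y / |P_L y| is the uniform measure on the unit sphere
  of L, this realizes exactly the process rho_p.\<close>
fun seq_hom :: "'v set \<Rightarrow> 'v set set \<Rightarrow> ('v \<Rightarrow> nat) \<Rightarrow> ('v \<Rightarrow> real^'d) \<Rightarrow> nat \<Rightarrow> ('v \<Rightarrow> real^'d)" where
  "seq_hom V E p y 0 = (\<lambda>v. 0)"
| "seq_hom V E p y (Suc k) =
     (let v = inv_into V p (Suc k); x = seq_hom V E p y k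
      in x(v := sgn (orth_proj (x ` Np E p v) (y v))))"

definition rho :: "'v set \<Rightarrow> 'v set set \<Rightarrow> ('v \<Rightarrow> nat) \<Rightarrow> ('v \<Rightarrow> real^'d) measure" where
  "rho V E p = distr (PiM V (\<lambda>_. unif_sphere)) (PiM V (\<lambda>_. borel))
                  (\<lambda>y. restrict (seq_hom V E p y (card V)) V)"

text \<open>The integrand defining t(G,d) for an ordering p (in ennreal; 1/Det = \<infinity> when Det = 0).\<close>
definition ortho_integrand :: "('d::finite) itself \<Rightarrow> 'v set \<Rightarrow> 'v set set \<Rightarrow> ('v \<Rightarrow> nat) \<Rightarrow> ('v \<Rightarrow> real^'d) \<Rightarrow> ennreal" where
  "ortho_integrand _ V E p x =
     ennreal (sphere_area (CARD('d) - 1) powi (int (card E) - int (card V))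
              / sphere_area (CARD('d) - 2) ^ card E)
     * (\<Prod>v\<in>V. ennreal (sphere_area (CARD('d) - card (Np E p v) - 1))
                  / ennreal (gram_Det (Np E p v) x))"

definition ortho_density_p :: "('d::finite) itself \<Rightarrow> 'v set \<Rightarrow> 'v set set \<Rightarrow> ('v \<Rightarrow> nat) \<Rightarrow> ennreal" where
  "ortho_density_p T V E p = (\<integral>\<^sup>+ x. ortho_integrand T V E p x \<partial>(rho V E p :: ('v \<Rightarrow> real^'d) measure))"

text \<open>t(G,d) with d = CARD('d); computed with some ordering p (the value is independent of p).\<close>
definition ortho_hom_density :: "('d::finite) itself \<Rightarrow> 'v set \<Rightarrow> 'v set set \<Rightarrow> ennreal" where
  "ortho_hom_density T V E =
     ortho_density_p T V E (SOME p. bij_betw p V {1..card V})"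

end

theory Submission
  imports Defs "HOL-Probability.Distributions"
begin

text \<open>
  The ordering in the definition of the density is arbitrary, so the density is compared with the one
  for an ordering that lists U first. Replace the constraint that \<open>x\<^sub>v\<close> is orthogonal to
  \<open>x\<^sub>w\<close> by the Gaussian kernel \<open>exp (- (x\<^sub>v \<bullet> x\<^sub>w)\<^sup>2 / e\<^sup>2) / e\<close>, and the uniform points on the
  sphere by Gaussian vectors in space. For every ordering, the integral of the product of these kernels over
  the edges equals the expectation of the product of the weights
  \<open>det (Gram (x\<^sub>w) + e\<^sup>2 I) powr (- 1/2)\<close> along a regularised sequential process, which for
  \<open>e \<rightarrow> 0\<close> tends pointwise to the original one, including at degenerate configurations, where the
  weights tend to infinity. By Fatou, the density for any ordering is at most a constant times the supremum over
  \<open>e\<close> of the kernel integrals, and for the ordering with U first these are at most the integral of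
  \<open>\<Prod>v\<in>W. 1 / Det (x (N v))\<close>. Finner's inequality with exponents
  \<open>d - deg v\<close> bounds this by a product of moments of \<open>1 / Det\<close>; these are
  finite because the distance of a Gaussian vector from a subspace of codimension \<open>m\<close> has finite inverse
  moments of all orders below \<open>m\<close>.
\<close>

text \<open>Orthogonal projection onto the complement of a family of vectors is discontinuous where
  the family becomes dependent, so two orderings are hard to compare at the level of the singular
  process. For \<open>e > 0\<close> this disappears: the kernel is symmetric in its two arguments,
  so the product over the edges does not see the ordering, and integrating one vector against its
  kernels is an explicit linear substitution in a Gaussian integral whose Jacobian, up to powers of
  \<open>e\<close>, is the inverse of the weight's denominator. Only inequalities are carried to the
  limit. With U first, the vectors of U are independent Gaussians left unchanged by the process, and
  the weights only grow when \<open>e\<close> is replaced by 0; this gives a bound uniform in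
  \<open>e\<close>. The hypothesis on G is the weight condition of Finner's inequality:
  \<open>u\<close> enters exactly the factors of its neighbours \<open>v\<close>, with exponents
  \<open>d - deg v\<close>. These exponents are just admissible: \<open>Det\<close> is a product of
  \<open>deg v\<close> distances, each to a span of at most \<open>deg v - 1\<close> vectors, hence
  of codimension at least \<open>d - deg v + 1\<close>.\<close>

section \<open>Rank-one changes of variables\<close>

text \<open>Uniqueness of Haar measure: integrate \<open>f x * g y\<close> against \<open>\<mu> \<Otimes>\<^sub>M lborel\<close> and translate in both variables.\<close>

lemma translation_invariant_eq_lborel:
  fixes \<mu> :: "'a::euclidean_space measure"
  assumes [measurable_cong]: "sets \<mu> = sets borel" and "sigma_finite_measure \<mu>"
    and inv: "\<And>a. distr \<mu> borel (\<lambda>x. a + x) = \<mu>"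
  obtains c where "\<And>f. f \<in> borel_measurable borel \<Longrightarrow> (\<integral>\<^sup>+x. f x \<partial>\<mu>) = c * (\<integral>\<^sup>+x. f x \<partial>lborel)"
proof -
  interpret \<mu>: sigma_finite_measure \<mu> by fact
  interpret pair_sigma_finite \<mu> lborel ..
  define g :: "'a \<Rightarrow> ennreal" where "g = indicator (cbox 0 One)"
  have [measurable]: "g \<in> borel_measurable borel" unfolding g_def by measurable
  have g: "(\<integral>\<^sup>+y. g y \<partial>lborel) = 1"
    unfolding g_def by simp
  have inv\<mu>: "(\<integral>\<^sup>+x. h (a + x) \<partial>\<mu>) = (\<integral>\<^sup>+x. h x \<partial>\<mu>)" if [measurable]: "h \<in> borel_measurable borel" for h a
    using nn_integral_distr[of "\<lambda>x. a + x" \<mu> borel h] by (simp add: inv)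
  have invl: "(\<integral>\<^sup>+x. h (a + x) \<partial>lborel) = (\<integral>\<^sup>+x. h x \<partial>lborel)"
    if [measurable]: "h \<in> borel_measurable borel" for h :: "'a \<Rightarrow> ennreal" and a
    using nn_integral_distr[of "\<lambda>x. a + x" lborel borel h] by (simp add: lborel_distr_plus)
  show ?thesis
  proof (rule that[of "\<integral>\<^sup>+x. g (- x) \<partial>\<mu>"])
    fix f :: "'a \<Rightarrow> ennreal" assume [measurable]: "f \<in> borel_measurable borel"
    have "(\<integral>\<^sup>+x. f x \<partial>\<mu>) = (\<integral>\<^sup>+y. (\<integral>\<^sup>+x. f x \<partial>\<mu>) * g y \<partial>lborel)"
      by (simp add: nn_integral_cmult g)
    also have "\<dots> = (\<integral>\<^sup>+y. (\<integral>\<^sup>+x. f (y + x) \<partial>\<mu>) * g y \<partial>lborel)"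
      by (simp add: inv\<mu>)
    also have "\<dots> = (\<integral>\<^sup>+y. (\<integral>\<^sup>+x. f (y + x) * g y \<partial>\<mu>) \<partial>lborel)"
      by (simp add: nn_integral_multc)
    also have "\<dots> = (\<integral>\<^sup>+x. (\<integral>\<^sup>+y. f (y + x) * g y \<partial>lborel) \<partial>\<mu>)"
      by (rule Fubini') measurable
    \<comment> \<open>The argument of \<open>g\<close> is rewritten through \<open>x + y\<close>, so
      that \<open>y\<close> occurs only in this sum and the inner Lebesgue integral can be
      translated by \<open>x\<close>.\<close>
    also have "\<dots> = (\<integral>\<^sup>+x. (\<integral>\<^sup>+y. f (x + y) * g (- x + (x + y)) \<partial>lborel) \<partial>\<mu>)"
      by (simp add: add.commute)
    also have "\<dots> = (\<integral>\<^sup>+x. (\<integral>\<^sup>+y. f y * g (- x + y) \<partial>lborel) \<partial>\<mu>)"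
      by (intro nn_integral_cong invl) measurable
    also have "\<dots> = (\<integral>\<^sup>+y. (\<integral>\<^sup>+x. f y * g (- x + y) \<partial>\<mu>) \<partial>lborel)"
      by (rule Fubini'[symmetric]) measurable
    also have "\<dots> = (\<integral>\<^sup>+y. f y * (\<integral>\<^sup>+x. g (- (- y + x)) \<partial>\<mu>) \<partial>lborel)"
      by (simp add: nn_integral_cmult)
    also have "\<dots> = (\<integral>\<^sup>+y. f y * (\<integral>\<^sup>+x. g (- x) \<partial>\<mu>) \<partial>lborel)"
      by (subst inv\<mu>) auto
    finally show "(\<integral>\<^sup>+x. f x \<partial>\<mu>) = (\<integral>\<^sup>+x. g (- x) \<partial>\<mu>) * (\<integral>\<^sup>+x. f x \<partial>lborel)"
      by (simp add: nn_integral_multc mult.commute)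
  qed
qed

text \<open>The image of Lebesgue measure under \<open>T\<close> is translation invariant, since
  every translation vector is \<open>T b\<close> for some \<open>b\<close>. Hence it is
  \<open>c\<close> times Lebesgue measure, and \<open>c = 1\<close> because \<open>T\<close>
  preserves the unit ball.\<close>

lemma nn_integral_lborel_orthogonal_transformation:
  fixes T :: "'a::euclidean_space \<Rightarrow> 'a" and f :: "'a \<Rightarrow> ennreal"
  assumes T: "orthogonal_transformation T" and [measurable]: "f \<in> borel_measurable borel"
  shows "(\<integral>\<^sup>+x. f (T x) \<partial>lborel) = (\<integral>\<^sup>+x. f x \<partial>lborel)"
proof -
  have lin: "linear T" using T by (rule orthogonal_transformation_linear)
  have [measurable]: "T \<in> borel \<rightarrow>\<^sub>M borel"
    by (intro borel_measurable_continuous_onI linear_continuous_on)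
      (simp add: lin linear_conv_bounded_linear[symmetric])
  let ?\<mu> = "distr lborel borel T"
  have ball: "emeasure ?\<mu> (ball 0 r) = emeasure lborel (ball (0::'a) r)" for r
  proof -
    have "T -` ball 0 r = ball (0::'a) r" by (auto simp: orthogonal_transformation_norm[OF T])
    then show ?thesis by (simp add: emeasure_distr)
  qed
  have sf: "sigma_finite_measure ?\<mu>"
  proof
    have "\<Union>(range (\<lambda>n::nat. ball (0::'a) (real n))) = UNIV"
      using reals_Archimedean2 by (auto simp: set_eq_iff)
    then show "\<exists>A. countable A \<and> A \<subseteq> sets ?\<mu> \<and> \<Union>A = space ?\<mu> \<and> (\<forall>a\<in>A. emeasure ?\<mu> a \<noteq> \<infinity>)"
      by (intro exI[of _ "range (\<lambda>n::nat. ball 0 (real n))"]) 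
        (auto simp: ball less_imp_neq[OF emeasure_lborel_ball_finite[of "0::'a"], simplified])
  qed
  have inv: "distr ?\<mu> borel (\<lambda>x. a + x) = ?\<mu>" for a
  proof -
    obtain b where b: "a = T b" using orthogonal_transformation_surj[OF T] by blast
    have "distr ?\<mu> borel (\<lambda>x. a + x) = distr lborel borel (\<lambda>x. T (b + x))"
      by (subst distr_distr) (auto simp: b linear_add[OF lin] comp_def)
    also have "\<dots> = distr (distr lborel borel (\<lambda>x. b + x)) borel T"
      by (subst distr_distr) (auto simp: comp_def)
    finally show ?thesis by (simp add: lborel_distr_plus)
  qed
  obtain c where c: "\<And>f. f \<in> borel_measurable borel \<Longrightarrow> (\<integral>\<^sup>+x. f x \<partial>?\<mu>) = c * (\<integral>\<^sup>+x. f x \<partial>lborel)"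
    using translation_invariant_eq_lborel[OF _ sf inv] by auto
  have "emeasure lborel (ball (0::'a) 1) = c * emeasure lborel (ball (0::'a) 1)"
    using c[OF borel_measurable_indicator, of "ball 0 1"] ball[of 1] by simp
  moreover have "emeasure lborel (ball (0::'a) 1) \<noteq> 0" "emeasure lborel (ball (0::'a) 1) \<noteq> top"
    using emeasure_lborel_ball_finite[of "0::'a" 1] open_not_negligible[of "ball (0::'a) 1"]
    by (auto simp: negligible_iff_emeasure0)
  ultimately have "c = 1"
    by (metis ennreal_mult_cancel_left mult.commute mult.right_neutral)
  then show ?thesis using c[of f] by (simp add: nn_integral_distr)
qed

text \<open>The map fixes the complement of \<open>q\<close> and stretches the direction of
  \<open>q\<close> by \<open>1 + t * (q \<bullet> q)\<close>, which is its determinant. A rotation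
  \<open>T\<close> taking a coordinate axis to the direction of \<open>q\<close> reduces it to a
  diagonal map \<open>S\<close>.\<close>

lemma nn_integral_lborel_rank_one:
  fixes q :: "real^'n" and f :: "real^'n \<Rightarrow> ennreal"
  assumes [measurable]: "f \<in> borel_measurable borel" and pos: "1 + t * (q \<bullet> q) > 0"
  shows "(\<integral>\<^sup>+z. f (z + (t * (q \<bullet> z)) *\<^sub>R q) \<partial>lborel) = ennreal (1 / (1 + t * (q \<bullet> q))) * (\<integral>\<^sup>+z. f z \<partial>lborel)"
proof -
  obtain k :: 'n where True by blast
  have "norm (norm q *\<^sub>R axis k (1::real)) = norm q" by simp
  then obtain T :: "real^'n \<Rightarrow> real^'n" where T: "orthogonal_transformation T" and q0: "T (norm q *\<^sub>R axis k 1) = q"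
    using orthogonal_transformation_exists by blast
  have lin: "linear T" using T by (rule orthogonal_transformation_linear)
  have [measurable]: "T \<in> borel \<rightarrow>\<^sub>M borel"
    by (intro borel_measurable_continuous_onI linear_continuous_on)
      (simp add: lin linear_conv_bounded_linear[symmetric])
  define e :: "real^'n" where "e = axis k 1"
  have e: "e \<in> Basis" by (auto simp: e_def Basis_vec_def)
  define m where "m = 1 + t * (q \<bullet> q)"
  define c where "c j = (if j = e then m else 1)" for j
  define S where "S x = 0 + (\<Sum>j\<in>Basis. (c j * (x \<bullet> j)) *\<^sub>R j)" for x :: "real^'n"
  have S: "S x = x + (t * (norm q)^2 * (x \<bullet> e)) *\<^sub>R e" for x
  proof -
    have "S x = (\<Sum>j\<in>Basis. (x \<bullet> j) *\<^sub>R j + (if j = e then ((m - 1) * (x \<bullet> j)) *\<^sub>R j else 0))"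
      unfolding S_def by (auto intro!: sum.cong simp: c_def algebra_simps)
    also have "\<dots> = x + ((m - 1) * (x \<bullet> e)) *\<^sub>R e"
      using e by (simp add: sum.distrib euclidean_representation)
    finally show ?thesis by (simp add: m_def power2_norm_eq_inner)
  qed
  have [measurable]: "S \<in> borel \<rightarrow>\<^sub>M borel" unfolding S_def by measurable
  have pc: "(\<Prod>j\<in>Basis. \<bar>c j\<bar>) = m"
    unfolding c_def using e pos by (subst prod.remove[of _ e]) (auto simp: m_def intro!: prod.neutral)
  have lb: "lborel = density (distr lborel borel S) (\<lambda>_. ennreal m)"
    using lborel_affine_euclidean[of c 0] pos unfolding S_def[symmetric, abs_def] pc
    by (auto simp: c_def m_def)
  have TS: "T (S z) = T z + (t * (q \<bullet> T z)) *\<^sub>R q" for z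
  proof -
    have nq: "norm q *\<^sub>R T e = q"
      using q0 linear_scale[OF lin] by (simp add: e_def)
    have "q \<bullet> T z = norm q * (T e \<bullet> T z)"
      by (metis nq inner_scaleR_left)
    then have "q \<bullet> T z = norm q * (z \<bullet> e)"
      using T by (simp add: orthogonal_transformation_def inner_commute)
    then have "T z + (t * (q \<bullet> T z)) *\<^sub>R q = T z + (t * (norm q * (z \<bullet> e))) *\<^sub>R (norm q *\<^sub>R T e)"
      by (simp add: nq)
    then show ?thesis
      unfolding S linear_add[OF lin] linear_scale[OF lin]
      by (simp add: power2_eq_square mult_ac)
  qed
  have "(\<integral>\<^sup>+z. f z \<partial>lborel) = (\<integral>\<^sup>+z. f (T z) \<partial>lborel)"
    by (simp add: nn_integral_lborel_orthogonal_transformation T)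
  also have "\<dots> = ennreal m * (\<integral>\<^sup>+z. f (T (S z)) \<partial>lborel)"
    by (subst lb) (simp add: nn_integral_density nn_integral_distr nn_integral_cmult)
  also have "(\<integral>\<^sup>+z. f (T (S z)) \<partial>lborel) = (\<integral>\<^sup>+z. f (z + (t * (q \<bullet> z)) *\<^sub>R q) \<partial>lborel)"
    unfolding TS by (rule nn_integral_lborel_orthogonal_transformation[OF T]) measurable
  finally show ?thesis
    using pos unfolding m_def[symmetric]
    by (simp add: mult.assoc[symmetric] ennreal_mult'[symmetric])
qed

section \<open>Regularised orthogonal projections and Gram determinants\<close>

text \<open>\<open>damp e q\<close> is the square root of the inverse of \<open>I + q q\<^sup>T / e\<^sup>2\<close>. Hence \<open>reg_proj e ws\<close>, with
  adjoint \<open>adj_proj e ws\<close>, is a matrix \<open>B\<close> with \<open>B B\<^sup>T = (I + (\<Sum>w. w w\<^sup>T) / e\<^sup>2)\<^sup>-\<^sup>1\<close> and determinant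
  \<open>e ^ length ws / reg_det e ws\<close>. For \<open>e = 0\<close>, division by zero makes \<open>damp 0 0\<close> the identity, so that both maps are the
  orthogonal projection onto the complement of \<open>ws\<close> even when \<open>ws\<close> is dependent.\<close>

definition damp :: "real \<Rightarrow> 'a::real_inner \<Rightarrow> 'a \<Rightarrow> 'a" where
  "damp e q z = z - ((q \<bullet> z) / (sqrt (e\<^sup>2 + q \<bullet> q) * (sqrt (e\<^sup>2 + q \<bullet> q) + e))) *\<^sub>R q"

fun adj_proj :: "real \<Rightarrow> 'a::real_inner list \<Rightarrow> 'a \<Rightarrow> 'a" where
  "adj_proj e [] x = x"
| "adj_proj e (w # ws) x = damp e (adj_proj e ws w) (adj_proj e ws x)"

text \<open>Why the recursion is right: let \<open>B\<close> belong to \<open>ws\<close>, let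
  \<open>q = B^T w\<close> and \<open>D = damp e q\<close>. Then \<open>B D\<close> times its
  transpose is \<open>B (I + q q^T / e^2)^-1 B^T\<close>, which is the inverse of
  \<open>(B B^T)^-1 + w w^T / e^2\<close>.\<close>

fun reg_proj :: "real \<Rightarrow> 'a::real_inner list \<Rightarrow> 'a \<Rightarrow> 'a" where
  "reg_proj e [] z = z"
| "reg_proj e (w # ws) z = reg_proj e ws (damp e (adj_proj e ws w) z)"

text \<open>Each factor is the square root of a Schur complement: adjoining \<open>w\<close>
  multiplies \<open>det (Gram + e^2 I)\<close> by \<open>e^2 + q \<bullet> q\<close> with
  \<open>q = adj_proj e ws w\<close>. For \<open>e = 0\<close> the factor is the distance of
  \<open>w\<close> from the span of \<open>ws\<close>.\<close>

fun reg_det :: "real \<Rightarrow> 'a::real_inner list \<Rightarrow> real" where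
  "reg_det e [] = 1"
| "reg_det e (w # ws) = sqrt (e\<^sup>2 + adj_proj e ws w \<bullet> adj_proj e ws w) * reg_det e ws"

lemma linear_damp: "linear (damp e q)"
  by (rule linearI) (auto simp: damp_def algebra_simps inner_simps add_divide_distrib)

lemma damp_symmetric: "damp e q x \<bullet> y = x \<bullet> damp e q y"
  by (simp add: damp_def inner_simps inner_commute)

lemma damp_orthogonal: "q \<bullet> z = 0 \<Longrightarrow> damp e q z = z"
  by (simp add: damp_def)

lemma damp_zero: "damp 0 q z = z - ((q \<bullet> z) / (q \<bullet> q)) *\<^sub>R q"
  by (simp add: damp_def)

text \<open>With \<open>r = sqrt (e^2 + q \<bullet> q)\<close> one has
  \<open>q \<bullet> q = (r - e) * (r + e)\<close>, so the eigenvalue along \<open>q\<close> is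
  \<open>1 - (r - e) / r = e / r\<close>.\<close>

lemma inner_damp:
  assumes "e > 0"
  shows "q \<bullet> damp e q z = (q \<bullet> z) * e / sqrt (e\<^sup>2 + q \<bullet> q)"
proof -
  define r where "r = sqrt (e\<^sup>2 + q \<bullet> q)"
  have r: "r > 0" "r\<^sup>2 = e\<^sup>2 + q \<bullet> q" using assms by (auto simp: r_def add_pos_nonneg)
  have qq: "q \<bullet> q = (r - e) * (r + e)" using r by (simp add: power2_eq_square algebra_simps)
  have "q \<bullet> damp e q z = (q \<bullet> z) - (q \<bullet> z) / (r * (r + e)) * ((r - e) * (r + e))"
    unfolding damp_def r_def[symmetric] by (simp add: inner_simps qq)
  also have "(q \<bullet> z) / (r * (r + e)) * ((r - e) * (r + e)) = ((q \<bullet> z) * (r - e)) * (r + e) / (r * (r + e))"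
    by simp
  also have "\<dots> = (q \<bullet> z) * (r - e) / r"
    using r assms by (intro nonzero_mult_divide_mult_cancel_right) auto
  also have "(q \<bullet> z) - (q \<bullet> z) * (r - e) / r = (q \<bullet> z) * e / r" using r by (simp add: field_simps)
  finally show ?thesis by (simp add: r_def)
qed

text \<open>The right-hand side is the Sherman-Morrison form of
  \<open>z^T (I + q q^T / e^2)^-1 z\<close>. Written without dividing by \<open>e\<close>, it also
  covers \<open>e = 0\<close>.\<close>

lemma damp_inner_self:
  assumes "e \<ge> 0"
  shows "damp e q z \<bullet> damp e q z = z \<bullet> z - (q \<bullet> z)\<^sup>2 / (e\<^sup>2 + q \<bullet> q)"
proof (cases "e\<^sup>2 + q \<bullet> q = 0")
  case True
  then have "q = 0" by (metis add_nonneg_eq_0_iff inner_eq_zero_iff inner_ge_zero zero_le_power2)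
  then show ?thesis by (simp add: damp_def)
next
  case False
  define r where "r = sqrt (e\<^sup>2 + q \<bullet> q)"
  have r: "r > 0" "r\<^sup>2 = e\<^sup>2 + q \<bullet> q"
    using False by (auto simp: r_def less_le)
  have qq: "q \<bullet> q = (r - e) * (r + e)" using r by (simp add: power2_eq_square algebra_simps)
  define a where "a = q \<bullet> z"
  have re: "r + e \<noteq> 0" using r assms by linarith
  define b where "b = a / (r * (r + e))"
  have a: "a = b * r * (r + e)" using r re by (simp add: b_def)
  have "damp e q z \<bullet> damp e q z = z \<bullet> z - 2 * b * a + b\<^sup>2 * (q \<bullet> q)"
    unfolding damp_def r_def[symmetric] b_def by (simp add: inner_simps a_def inner_commute power2_eq_square algebra_simps)
  also have "\<dots> = z \<bullet> z - (b * (r + e))\<^sup>2"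
    unfolding qq a by algebra
  also have "(b * (r + e))\<^sup>2 = a\<^sup>2 / r\<^sup>2"
    using r(1) by (simp add: a power_mult_distrib)
  finally show ?thesis by (simp add: a_def r)
qed

lemma norm_damp_le: "e \<ge> 0 \<Longrightarrow> norm (damp e q z) \<le> norm z"
  unfolding norm_le damp_inner_self by (simp add: field_simps)

text \<open>The exponent identity behind the substitution \<open>x = damp e q z\<close>: the
  Gaussian weight of \<open>z\<close> is that of \<open>x\<close> times the exponential of the
  kernel in \<open>q \<bullet> x\<close>.\<close>

lemma inner_self_eq_damp:
  assumes "e > 0"
  shows "z \<bullet> z = damp e q z \<bullet> damp e q z + (q \<bullet> damp e q z)\<^sup>2 / e\<^sup>2"
  using assms add_pos_nonneg[of "e\<^sup>2" "q \<bullet> q"]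
  by (simp add: inner_damp damp_inner_self power_divide power_mult_distrib)

lemma linear_adj_proj: "linear (adj_proj e ws)"
proof (induction ws)
  case (Cons w ws)
  then show ?case
    using linear_compose[OF Cons linear_damp[of e "adj_proj e ws w"]] by (simp add: comp_def cong: if_cong) 
qed (simp add: linear_id[unfolded id_def] )

lemma reg_proj_adjoint: "reg_proj e ws z \<bullet> x = z \<bullet> adj_proj e ws x"
  by (induction ws arbitrary: z x) (auto simp: damp_symmetric)

lemma norm_reg_proj_le: "e \<ge> 0 \<Longrightarrow> norm (reg_proj e ws z) \<le> norm z"
  by (induction ws arbitrary: z) (auto intro: order_trans norm_damp_le)

lemma norm_adj_proj_le: "e \<ge> 0 \<Longrightarrow> norm (adj_proj e ws z) \<le> norm z"
  by (induction ws arbitrary: z) (auto intro: order_trans norm_damp_le)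

lemma reg_proj_orthogonal:
  assumes "\<And>w. w \<in> set ws \<Longrightarrow> z \<bullet> w = 0"
  shows "reg_proj e ws z = z"
  using assms
proof (induction ws)
  case (Cons w ws)
  then have "reg_proj e ws z = z" by simp
  then have "z \<bullet> adj_proj e ws w = z \<bullet> w" by (metis reg_proj_adjoint)
  then show ?case using Cons by (simp add: damp_orthogonal inner_commute)
qed simp

section \<open>The case e = 0: Gram-Schmidt residuals and the closest-point projection\<close>

lemma adj_proj_0_span: "x - adj_proj 0 ws x \<in> span (set ws)"
proof (induction ws arbitrary: x)
  case (Cons w ws)
  let ?q = "adj_proj 0 ws w" and ?y = "adj_proj 0 ws x"
  have sub: "span (set ws) \<subseteq> span (set (w # ws))" by (intro span_mono) auto
  have "w - ?q \<in> span (set (w # ws))" "x - ?y \<in> span (set (w # ws))"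
    using Cons sub by blast+
  moreover have "w \<in> span (set (w # ws))" by (simp add: span_base)
  ultimately have q: "?q \<in> span (set (w # ws))" "x - ?y \<in> span (set (w # ws))"
    using span_diff[of w "set (w # ws)" "w - ?q"] by auto
  have "x - adj_proj 0 (w # ws) x = (x - ?y) + ((?q \<bullet> ?y) / (?q \<bullet> ?q)) *\<^sub>R ?q"
    by (simp add: damp_zero)
  then show ?case using q by (metis span_add span_scale)
qed (simp add: span_zero)

text \<open>Each step removes the component along the residual \<open>?q\<close> of the new vector
  \<open>a\<close>. As \<open>a - ?q\<close> lies in the old span, orthogonality to
  \<open>?q\<close> and to the old vectors gives orthogonality to \<open>a\<close>.\<close>

lemma adj_proj_0_orthogonal: "w \<in> set ws \<Longrightarrow> adj_proj 0 ws x \<bullet> w = 0"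
proof (induction ws arbitrary: x w)
  case (Cons a ws)
  let ?q = "adj_proj 0 ws a" and ?y = "adj_proj 0 ws x"
  have orth: "adj_proj 0 ws z \<bullet> s = 0" if "s \<in> span (set ws)" for s z
    using orthogonal_to_span[OF that, of "adj_proj 0 ws z"] Cons.IH
    by (auto simp: orthogonal_def)
  show ?case
  proof (cases "w \<in> set ws")
    case True
    then show ?thesis using Cons.IH by (simp add: damp_zero inner_simps)
  next
    case False
    then have w: "w = a" using Cons.prems by simp
    have "adj_proj 0 ws z \<bullet> (a - ?q) = 0" for z
      by (intro orth adj_proj_0_span)
    then have "adj_proj 0 ws z \<bullet> a = adj_proj 0 ws z \<bullet> ?q" for z
      by (simp add: inner_simps)
    then show ?thesis
      by (simp add: w damp_zero inner_simps inner_commute)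
  qed
qed simp

lemma adj_proj_0_orthogonal_span: "s \<in> span (set ws) \<Longrightarrow> adj_proj 0 ws x \<bullet> s = 0"
  using orthogonal_to_span[of s "set ws" "adj_proj 0 ws x"] adj_proj_0_orthogonal
  by (auto simp: orthogonal_def)

text \<open>The two maps are adjoint to each other, and an orthogonal projection is
  self-adjoint.\<close>

lemma reg_proj_0: "reg_proj 0 ws = adj_proj 0 ws"
proof
  fix z
  have "reg_proj 0 ws z \<bullet> x = adj_proj 0 ws z \<bullet> x" for x
  proof -
    have "(z - adj_proj 0 ws z) \<bullet> adj_proj 0 ws x = 0"
      by (metis adj_proj_0_orthogonal_span adj_proj_0_span inner_commute)
    moreover have "adj_proj 0 ws z \<bullet> (x - adj_proj 0 ws x) = 0"
      by (metis adj_proj_0_orthogonal_span adj_proj_0_span)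
    ultimately show ?thesis by (simp add: reg_proj_adjoint inner_simps)
  qed
  then show "reg_proj 0 ws z = adj_proj 0 ws z" using vector_eq_rdot by blast
qed

lemma adj_proj_0_unique:
  assumes "\<And>w. w \<in> set ws \<Longrightarrow> p \<bullet> w = 0" "x - p \<in> span (set ws)"
  shows "adj_proj 0 ws x = p"
proof -
  let ?d = "adj_proj 0 ws x - p"
  have "(x - p) - (x - adj_proj 0 ws x) \<in> span (set ws)"
    by (intro span_diff assms adj_proj_0_span)
  then have d: "?d \<in> span (set ws)" by (simp add: algebra_simps)
  have "orthogonal p ?d" using assms(1) d
    by (intro orthogonal_to_span[OF d]) (auto simp: orthogonal_def)
  then have "?d \<bullet> ?d = 0"
    using adj_proj_0_orthogonal_span[OF d] by (simp add: inner_simps orthogonal_def)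
  then show ?thesis by simp
qed

lemma orth_proj_eq_reg_proj: "orth_proj (set ws) y = reg_proj 0 ws y"
proof -
  let ?L = "{z. \<forall>w\<in>set ws. z \<bullet> w = 0}" and ?p = "adj_proj 0 ws y"
  have "?p = closest_point ?L y"
  proof (rule closest_point_unique)
    have L: "?L = (\<Inter>w\<in>set ws. {z. w \<bullet> z = 0})" by (auto simp: inner_commute)
    show "convex ?L" unfolding L by (intro convex_INT convex_hyperplane)
    show "closed ?L" unfolding L by (intro closed_INT ballI closed_hyperplane)
    show "?p \<in> ?L" by (simp add: adj_proj_0_orthogonal)
    show "\<forall>z\<in>?L. dist y ?p \<le> dist y z"
    proof
      fix z assume z: "z \<in> ?L"
      have "orthogonal (?p - z) (y - ?p)"
        using z adj_proj_0_orthogonal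
        by (intro orthogonal_to_span[OF adj_proj_0_span]) (auto simp: orthogonal_def inner_simps)
      then have "(norm ((?p - z) + (y - ?p)))\<^sup>2 = (norm (?p - z))\<^sup>2 + (norm (y - ?p))\<^sup>2"
        by (rule norm_add_Pythagorean)
      then have "(norm (y - ?p))\<^sup>2 \<le> (norm (y - z))\<^sup>2" by simp
      then show "dist y ?p \<le> dist y z" by (simp add: dist_norm power2_le_iff_abs_le)
    qed
  qed
  then show ?thesis by (simp add: orth_proj_def reg_proj_0)
qed

text \<open>The projection \<open>?p\<close> of \<open>x\<close> is fixed by
  \<open>reg_proj e ws\<close>. Moving that map across the inner product gives
  \<open>?p \<bullet> ?p = ?p \<bullet> adj_proj e ws x\<close>, and Cauchy-Schwarz applies.\<close>

lemma norm_adj_proj_0_le: "norm (adj_proj 0 ws x) \<le> norm (adj_proj e ws x)"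
proof -
  let ?p = "adj_proj 0 ws x"
  have "x \<bullet> ?p = ?p \<bullet> ?p"
    using adj_proj_0_orthogonal_span[OF adj_proj_0_span, of ws x x] by (simp add: inner_simps inner_commute)
  moreover have "reg_proj e ws ?p = ?p" by (intro reg_proj_orthogonal adj_proj_0_orthogonal)
  ultimately have "?p \<bullet> ?p = ?p \<bullet> adj_proj e ws x" by (metis reg_proj_adjoint inner_commute)
  also have "\<dots> \<le> norm ?p * norm (adj_proj e ws x)" by (rule norm_cauchy_schwarz)
  finally have "norm ?p * norm ?p \<le> norm ?p * norm (adj_proj e ws x)" 
    by (simp add: dot_square_norm power2_eq_square)
  then show ?thesis
    by (cases "norm ?p = 0") (auto simp: mult_le_cancel_left)
qed

lemma reg_det_nonneg: "reg_det e ws \<ge> 0"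
  by (induction ws) auto

lemma reg_det_pos: "e > 0 \<Longrightarrow> reg_det e ws > 0"
  by (induction ws) (auto simp: add_pos_nonneg)

text \<open>Source of uniformity in \<open>e\<close>: a regularised weight never exceeds the weight
  at \<open>e = 0\<close> of the same vectors.\<close>

lemma reg_det_0_le: "reg_det 0 ws \<le> reg_det e ws"
proof (induction ws)
  case (Cons w ws)
  have "adj_proj 0 ws w \<bullet> adj_proj 0 ws w \<le> e\<^sup>2 + adj_proj e ws w \<bullet> adj_proj e ws w"
    using norm_adj_proj_0_le[of ws w e] by (simp add: norm_le add_increasing)
  then show ?case using Cons by (auto intro!: mult_mono reg_det_nonneg simp del: real_sqrt_abs)
qed simp

text \<open>A bound independent of \<open>e\<close>; it keeps later weights away from 0 once an
  earlier weight tends to infinity.\<close>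

lemma reg_det_le:
  assumes "0 \<le> e" "e \<le> 1"
  shows "reg_det e ws \<le> (\<Prod>w\<leftarrow>ws. 1 + norm w)"
proof (induction ws)
  case (Cons w ws)
  have "sqrt (e\<^sup>2 + adj_proj e ws w \<bullet> adj_proj e ws w) \<le> sqrt (e\<^sup>2) + sqrt (adj_proj e ws w \<bullet> adj_proj e ws w)"
    by (intro sqrt_add_le_add_sqrt) auto
  also have "\<dots> \<le> 1 + norm w"
    using assms norm_adj_proj_le[of e ws w] by (simp flip: norm_eq_sqrt_inner)
  finally show ?case using Cons by (auto intro!: mult_mono reg_det_nonneg)
qed simp

section \<open>Measurability of the regularised maps\<close>

lemma borel_measurable_damp[measurable (raw)]:
  fixes q x :: "'b \<Rightarrow> 'a::euclidean_space"
  assumes [measurable]: "q \<in> borel_measurable M" "x \<in> borel_measurable M"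
  shows "(\<lambda>\<omega>. damp e (q \<omega>) (x \<omega>)) \<in> borel_measurable M"
  unfolding damp_def by measurable

lemma borel_measurable_adj_proj:
  fixes f :: "'i \<Rightarrow> 'b \<Rightarrow> 'a::euclidean_space"
  assumes "\<And>i. i \<in> set is \<Longrightarrow> f i \<in> borel_measurable M" "g \<in> borel_measurable M"
  shows "(\<lambda>\<omega>. adj_proj e (map (\<lambda>i. f i \<omega>) is) (g \<omega>)) \<in> borel_measurable M"
  using assms by (induction "is" arbitrary: g) auto

lemma borel_measurable_reg_proj:
  fixes f :: "'i \<Rightarrow> 'b \<Rightarrow> 'a::euclidean_space"
  assumes "\<And>i. i \<in> set is \<Longrightarrow> f i \<in> borel_measurable M" "g \<in> borel_measurable M"
  shows "(\<lambda>\<omega>. reg_proj e (map (\<lambda>i. f i \<omega>) is) (g \<omega>)) \<in> borel_measurable M"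
  using assms
proof (induction "is" arbitrary: g)
  case (Cons i "is")
  have "(\<lambda>\<omega>. damp e (adj_proj e (map (\<lambda>i. f i \<omega>) is) (f i \<omega>)) (g \<omega>)) \<in> borel_measurable M"
    using Cons.prems by (intro borel_measurable_damp borel_measurable_adj_proj) auto
  with Cons show ?case by simp
qed simp

lemma borel_measurable_reg_det:
  fixes f :: "'i \<Rightarrow> 'b \<Rightarrow> 'a::euclidean_space"
  assumes "\<And>i. i \<in> set is \<Longrightarrow> f i \<in> borel_measurable M"
  shows "(\<lambda>\<omega>. reg_det e (map (\<lambda>i. f i \<omega>) is)) \<in> borel_measurable M"
  using assms
proof (induction "is")
  case (Cons i "is")
  have [measurable]: "(\<lambda>\<omega>. adj_proj e (map (\<lambda>i. f i \<omega>) is) (f i \<omega>)) \<in> borel_measurable M"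
    using Cons.prems by (intro borel_measurable_adj_proj) auto
  have [measurable]: "(\<lambda>\<omega>. reg_det e (map (\<lambda>i. f i \<omega>) is)) \<in> borel_measurable M"
    using Cons by auto
  show ?case by simp
qed simp

section \<open>Limits as e tends to 0\<close>

lemma tendsto_damp:
  assumes e: "e \<longlonglongrightarrow> 0" and q: "q \<longlonglongrightarrow> q0" and x: "x \<longlonglongrightarrow> x0" and "q0 \<noteq> 0"
  shows "(\<lambda>n. damp (e n) (q n) (x n)) \<longlonglongrightarrow> damp 0 q0 x0"
  unfolding damp_def
  by (intro tendsto_intros e q x) (use assms in auto)

text \<open>\<open>damp 0 q\<close> jumps at \<open>q = 0\<close>, so every residual must be nonzero
  in the limit; this is what \<open>nz\<close> says.\<close>

lemma tendsto_adj_proj: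
  assumes e: "e \<longlonglongrightarrow> 0" and x: "\<And>i. i \<in> set is \<Longrightarrow> (\<lambda>n. x n i) \<longlonglongrightarrow> x0 i"
    and nz: "reg_det 0 (map x0 is) \<noteq> 0" and g: "g \<longlonglongrightarrow> g0"
  shows "(\<lambda>n. adj_proj (e n) (map (x n) is) (g n)) \<longlonglongrightarrow> adj_proj 0 (map x0 is) g0"
  using x nz g
proof (induction "is" arbitrary: g g0)
  case (Cons i "is")
  then show ?case by (auto intro!: tendsto_damp e)
qed simp

lemma tendsto_reg_proj:
  assumes e: "e \<longlonglongrightarrow> 0" and x: "\<And>i. i \<in> set is \<Longrightarrow> (\<lambda>n. x n i) \<longlonglongrightarrow> x0 i"
    and nz: "reg_det 0 (map x0 is) \<noteq> 0" and g: "g \<longlonglongrightarrow> g0"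
  shows "(\<lambda>n. reg_proj (e n) (map (x n) is) (g n)) \<longlonglongrightarrow> reg_proj 0 (map x0 is) g0"
  using x nz g
proof (induction "is" arbitrary: g g0)
  case (Cons i "is")
  have "(\<lambda>n. damp (e n) (adj_proj (e n) (map (x n) is) (x n i)) (g n))
      \<longlonglongrightarrow> damp 0 (adj_proj 0 (map x0 is) (x0 i)) g0"
    using Cons.prems by (intro tendsto_damp tendsto_adj_proj e) auto
  then show ?case using Cons by auto
qed simp

text \<open>Independence is not assumed. If the tail is dependent in the limit, \<open>?q\<close>
  may fail to converge, but it is bounded by the norm of the new vector while the determinant of the
  tail tends to 0.\<close>

lemma tendsto_reg_det:
  assumes e: "e \<longlonglongrightarrow> 0" "\<And>n. 0 \<le> e n" and x: "\<And>i. i \<in> set is \<Longrightarrow> (\<lambda>n. x n i) \<longlonglongrightarrow> x0 i"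
  shows "(\<lambda>n. reg_det (e n) (map (x n) is)) \<longlonglongrightarrow> reg_det 0 (map x0 is)"
  using x
proof (induction "is")
  case (Cons i "is")
  then have IH: "(\<lambda>n. reg_det (e n) (map (x n) is)) \<longlonglongrightarrow> reg_det 0 (map x0 is)" by simp
  let ?q = "\<lambda>n. adj_proj (e n) (map (x n) is) (x n i)"
  show ?case
  proof (cases "reg_det 0 (map x0 is) = 0")
    case False
    have "?q \<longlonglongrightarrow> adj_proj 0 (map x0 is) (x0 i)"
      using Cons.prems False by (intro tendsto_adj_proj e) auto
    then show ?thesis
      unfolding list.map reg_det.simps by (intro tendsto_intros IH e)
  next
    case True
    have "(\<lambda>n. sqrt ((e n)\<^sup>2 + x n i \<bullet> x n i) * reg_det (e n) (map (x n) is)) \<longlonglongrightarrow> sqrt (0\<^sup>2 + x0 i \<bullet> x0 i) * reg_det 0 (map x0 is)"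
      using Cons.prems by (intro tendsto_intros IH e) auto
    then have lim: "(\<lambda>n. sqrt ((e n)\<^sup>2 + x n i \<bullet> x n i) * reg_det (e n) (map (x n) is)) \<longlonglongrightarrow> 0"
      by (simp add: True)
    have "?q n \<bullet> ?q n \<le> x n i \<bullet> x n i" for n
      using norm_adj_proj_le[OF e(2)[of n], of "map (x n) is" "x n i"] by (simp add: norm_le)
    then have up: "\<forall>\<^sub>F n in sequentially. reg_det (e n) (map (x n) (i # is)) \<le> sqrt ((e n)\<^sup>2 + x n i \<bullet> x n i) * reg_det (e n) (map (x n) is)"
      by (intro always_eventually) (auto intro!: mult_right_mono reg_det_nonneg)
    have "(\<lambda>n. reg_det (e n) (map (x n) (i # is))) \<longlonglongrightarrow> 0"
      by (rule tendsto_sandwich[OF _ up tendsto_const lim]) (simp add: reg_det_nonneg)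
    then show ?thesis by (simp add: True)
  qed
qed simp

section \<open>Gaussian integrals\<close>

text \<open>Coordinates have variance 1/2, so that the exponent is \<open>x \<bullet> x\<close> and
  \<open>inner_self_eq_damp\<close> applies without further constants.\<close>

definition gauss :: "'a::euclidean_space measure" where
  "gauss = density lborel (\<lambda>x. ennreal (exp (- (x \<bullet> x)) / sqrt pi ^ DIM('a)))"

lemma sets_gauss[simp, measurable_cong]: "sets gauss = sets borel"
  by (simp add: gauss_def)

lemma space_gauss[simp]: "space gauss = UNIV"
  by (simp add: gauss_def)

lemma nn_integral_gauss:
  fixes f :: "'a::euclidean_space \<Rightarrow> ennreal"
  assumes [measurable]: "f \<in> borel_measurable borel"
  shows "(\<integral>\<^sup>+x. f x \<partial>gauss) = (\<integral>\<^sup>+x. ennreal (exp (- (x \<bullet> x)) / sqrt pi ^ DIM('a)) * f x \<partial>lborel)"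
  unfolding gauss_def by (subst nn_integral_density) auto

lemma prob_space_gauss: "prob_space (gauss :: 'a::euclidean_space measure)"
proof
  interpret N: prob_space "density lborel (normal_density 0 (sqrt (1/2)))"
    by (rule prob_space_normal_density) simp
  have nd: "normal_density 0 (sqrt (1/2)) x = exp (- x\<^sup>2) / sqrt pi" for x
    by (simp add: normal_density_def power2_eq_square)
  have one: "(\<integral>\<^sup>+x. ennreal (exp (- x\<^sup>2) / sqrt pi) \<partial>lborel) = 1"
    using N.emeasure_space_1 by (simp add: emeasure_density nd)
  have "ennreal (exp (- (x \<bullet> x)) / sqrt pi ^ DIM('a)) = (\<Prod>b\<in>Basis. ennreal (exp (- (x \<bullet> b)\<^sup>2) / sqrt pi))" for x :: 'a
    by (simp add: prod_ennreal euclidean_inner[of x x] prod_dividef exp_sum sum_negf[symmetric] power2_eq_square)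
  then have "emeasure (gauss :: 'a measure) (space gauss) = (\<integral>\<^sup>+x. (\<Prod>b\<in>Basis. ennreal (exp (- (x \<bullet> b)\<^sup>2) / sqrt pi)) \<partial>(lborel :: 'a measure))"
    unfolding gauss_def by (simp add: emeasure_density)
  also have "\<dots> = (\<Prod>b\<in>(Basis::'a set). (\<integral>\<^sup>+x. ennreal (exp (- x\<^sup>2) / sqrt pi) \<partial>lborel))"
    by (rule nn_integral_lborel_prod) auto
  finally show "emeasure (gauss :: 'a measure) (space gauss) = 1" by (simp add: one)
qed

interpretation gauss: prob_space "gauss :: 'a::euclidean_space measure"
  by (rule prob_space_gauss)

text \<open>As a function of the real number \<open>x \<bullet> w\<close> this has integral
  \<open>sqrt pi\<close> for every \<open>e > 0\<close>; for small \<open>e\<close> it approximates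
  a multiple of the delta function at orthogonality.\<close>

definition kern :: "real \<Rightarrow> 'a::real_inner \<Rightarrow> 'a \<Rightarrow> ennreal" where
  "kern e x w = ennreal (exp (- (x \<bullet> w)\<^sup>2 / e\<^sup>2) / e)"

lemma kern_commute: "kern e x w = kern e w x"
  by (simp add: kern_def inner_commute)

lemma borel_measurable_kern[measurable (raw)]:
  fixes f g :: "'b \<Rightarrow> 'a::euclidean_space"
  assumes [measurable]: "f \<in> borel_measurable M" "g \<in> borel_measurable M"
  shows "(\<lambda>\<omega>. kern e (f \<omega>) (g \<omega>)) \<in> borel_measurable M"
  unfolding kern_def by measurable

lemma borel_measurable_reg_proj_fixed[measurable]:
  fixes ws :: "'a::euclidean_space list"
  shows "reg_proj e ws \<in> borel_measurable borel"
proof -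
  have "(\<lambda>x. reg_proj e (map (\<lambda>i. i) ws) x) \<in> borel_measurable borel"
    by (intro borel_measurable_reg_proj) auto
  then show ?thesis by simp
qed

lemma borel_measurable_adj_proj_fixed[measurable]:
  fixes ws :: "'a::euclidean_space list"
  shows "adj_proj e ws \<in> borel_measurable borel"
proof -
  have "(\<lambda>x. adj_proj e (map (\<lambda>i. i) ws) x) \<in> borel_measurable borel"
    by (intro borel_measurable_adj_proj) auto
  then show ?thesis by simp
qed

text \<open>Substitute \<open>x = damp e q z\<close>, whose Jacobian is \<open>e / r\<close>. The
  exponent identity produces the kernel exponential, and the factor \<open>1 / e\<close> left over
  is its normalisation.\<close>

lemma nn_integral_damp_gauss:
  fixes q :: "real^'n" and h :: "real^'n \<Rightarrow> ennreal"
  assumes e: "e > 0" and [measurable]: "h \<in> borel_measurable borel"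
  shows "(\<integral>\<^sup>+z. h (damp e q z) \<partial>gauss)
    = ennreal (sqrt (e\<^sup>2 + q \<bullet> q)) * (\<integral>\<^sup>+x. ennreal (exp (- (q \<bullet> x)\<^sup>2 / e\<^sup>2) / e) * h x \<partial>gauss)"
proof -
  define r where "r = sqrt (e\<^sup>2 + q \<bullet> q)"
  have r: "r > 0" "r\<^sup>2 = e\<^sup>2 + q \<bullet> q" using e by (auto simp: r_def add_pos_nonneg)
  have qq: "q \<bullet> q = (r - e) * (r + e)" using r by (simp add: power2_eq_square algebra_simps)
  define t where "t = - 1 / (r * (r + e))"
  have "(q \<bullet> q) / (r * (r + e)) = (r - e) / r"
    unfolding qq using r e by (intro nonzero_mult_divide_mult_cancel_right) auto
  then have t: "1 + t * (q \<bullet> q) = e / r" using r(1) by (simp add: t_def diff_divide_distrib)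
  have damp: "damp e q z = z + (t * (q \<bullet> z)) *\<^sub>R q" for z
    by (simp add: damp_def t_def r_def)
  define c where "c = sqrt pi ^ DIM(real^'n)"
  have c: "c > 0" by (simp add: c_def)
  define F where "F x = ennreal (exp (- (x \<bullet> x)) / c) * (ennreal (exp (- (q \<bullet> x)\<^sup>2 / e\<^sup>2)) * h x)" for x
  have [measurable]: "F \<in> borel_measurable borel" unfolding F_def by measurable
  have [measurable]: "damp e q \<in> borel_measurable borel"
    by (rule borel_measurable_damp) auto
  have F: "ennreal (exp (- (z \<bullet> z)) / c) * h (damp e q z) = F (z + (t * (q \<bullet> z)) *\<^sub>R q)" for z
  proof -
    let ?d = "damp e q z"
    have "- (z \<bullet> z) = - (?d \<bullet> ?d) + - (q \<bullet> ?d)\<^sup>2 / e\<^sup>2"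
      using inner_self_eq_damp[OF e, of z q] by linarith
    then have "exp (- (z \<bullet> z)) / c = exp (- (?d \<bullet> ?d)) / c * exp (- (q \<bullet> ?d)\<^sup>2 / e\<^sup>2)"
      by (simp only: exp_add times_divide_eq_left)
    then have "ennreal (exp (- (z \<bullet> z)) / c) = ennreal (exp (- (?d \<bullet> ?d)) / c) * ennreal (exp (- (q \<bullet> ?d)\<^sup>2 / e\<^sup>2))"
      by (simp only: ennreal_mult'' exp_ge_zero)
    then show ?thesis unfolding F_def damp[symmetric] by (simp only: mult.assoc)
  qed
  have "(\<integral>\<^sup>+z. h (damp e q z) \<partial>gauss) = (\<integral>\<^sup>+z. F (z + (t * (q \<bullet> z)) *\<^sub>R q) \<partial>lborel)"
    unfolding F[symmetric] unfolding c_def by (rule nn_integral_gauss) measurable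
  also have "\<dots> = ennreal (r / e) * (\<integral>\<^sup>+z. F z \<partial>lborel)"
    using r e t by (subst nn_integral_lborel_rank_one) auto
  also have "(\<integral>\<^sup>+z. F z \<partial>lborel) = (\<integral>\<^sup>+x. ennreal (exp (- (q \<bullet> x)\<^sup>2 / e\<^sup>2)) * h x \<partial>gauss)"
    by (simp add: nn_integral_gauss F_def c_def)
  also have "\<dots> = (\<integral>\<^sup>+x. ennreal e * (ennreal (exp (- (q \<bullet> x)\<^sup>2 / e\<^sup>2) / e) * h x) \<partial>gauss)"
    using e by (simp add: mult.assoc[symmetric] ennreal_mult'[symmetric])
  also have "\<dots> = ennreal e * (\<integral>\<^sup>+x. ennreal (exp (- (q \<bullet> x)\<^sup>2 / e\<^sup>2) / e) * h x \<partial>gauss)"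
    by (rule nn_integral_cmult) measurable
  finally show ?thesis
    using r e by (simp add: r_def[symmetric] mult.assoc[symmetric] ennreal_mult'[symmetric])
qed

lemma nn_integral_reg_proj:
  fixes ws :: "(real^'n) list" and f :: "real^'n \<Rightarrow> ennreal"
  assumes e: "e > 0" and "f \<in> borel_measurable borel"
  shows "(\<integral>\<^sup>+z. f (reg_proj e ws z) \<partial>gauss)
    = ennreal (reg_det e ws) * (\<integral>\<^sup>+x. (\<Prod>w\<leftarrow>ws. kern e x w) * f x \<partial>gauss)"
  using assms(2)
proof (induction ws arbitrary: f)
  case (Cons w ws)
  note [measurable] = Cons.prems
  let ?q = "adj_proj e ws w"
  have m: "(\<lambda>x. \<Prod>w\<leftarrow>ws. kern e x w) \<in> borel_measurable borel" for ws :: "(real^'n) list"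
    by (induction ws) auto
  note m[measurable]
  \<comment> \<open>By adjointness the kernel in the residual \<open>?q\<close> at \<open>x\<close>
    is the kernel in \<open>w\<close> at the image point, so it can join \<open>f\<close> in the
    induction hypothesis.\<close>
  have qx: "?q \<bullet> x = reg_proj e ws x \<bullet> w" for x
    by (metis reg_proj_adjoint inner_commute)
  have "(\<integral>\<^sup>+z. f (reg_proj e (w # ws) z) \<partial>gauss)
    = ennreal (sqrt (e\<^sup>2 + ?q \<bullet> ?q)) * (\<integral>\<^sup>+x. ennreal (exp (- (reg_proj e ws x \<bullet> w)\<^sup>2 / e\<^sup>2) / e) * f (reg_proj e ws x) \<partial>gauss)"
    using nn_integral_damp_gauss[OF e, of "\<lambda>x. f (reg_proj e ws x)" ?q] unfolding qx[symmetric] by simp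
  also have "(\<integral>\<^sup>+x. ennreal (exp (- (reg_proj e ws x \<bullet> w)\<^sup>2 / e\<^sup>2) / e) * f (reg_proj e ws x) \<partial>gauss)
     = ennreal (reg_det e ws) * (\<integral>\<^sup>+x. (\<Prod>w\<leftarrow>ws. kern e x w) * (kern e x w * f x) \<partial>gauss)"
    unfolding kern_def[symmetric] by (rule Cons.IH[of "\<lambda>x. kern e x w * f x"]) measurable
  finally show ?case
    by (simp add: ennreal_mult' reg_det_nonneg mult_ac)
qed simp

text \<open>The substitution stretches the span of \<open>ws\<close> by \<open>l\<close> and fixes
  its complement. Its determinant is \<open>l\<close> to the dimension of the span, at most
  \<open>l ^ length ws\<close>; it is composed of one rank-one stretch per vector.\<close>

lemma nn_integral_lborel_stretch_le:
  fixes ws :: "(real^'n) list" and F :: "real^'n \<Rightarrow> ennreal"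
  assumes "l \<ge> 1" and "F \<in> borel_measurable borel"
  shows "(\<integral>\<^sup>+x. F x \<partial>lborel) \<le> ennreal (l ^ length ws) * (\<integral>\<^sup>+z. F (adj_proj 0 ws z + l *\<^sub>R (z - adj_proj 0 ws z)) \<partial>lborel)"
  using assms(2)
proof (induction ws)
  case (Cons w ws)
  note [measurable] = Cons.prems
  let ?q = "adj_proj 0 ws w"
  \<comment> \<open>A stretch by \<open>l\<close> along \<open>?q\<close>. If \<open>w\<close>
    depends on \<open>ws\<close>, then \<open>?q = 0\<close>, so \<open>t = 0\<close> and the factor
    is 1 instead of \<open>l\<close>; hence only an inequality.\<close>
  define t where "t = (l - 1) / (?q \<bullet> ?q)"
  define st where "st vs z = adj_proj 0 vs z + l *\<^sub>R (z - adj_proj 0 vs z)" for vs and z :: "real^'n"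
  have [measurable]: "st vs \<in> borel_measurable borel" for vs unfolding st_def by measurable
  have t: "1 \<le> 1 + t * (?q \<bullet> ?q)" "1 + t * (?q \<bullet> ?q) \<le> l"
    using assms(1) by (auto simp: t_def)
  have qq: "adj_proj 0 ws ?q = ?q"
    by (rule adj_proj_0_unique) (auto simp: adj_proj_0_orthogonal span_zero)
  have qz: "?q \<bullet> adj_proj 0 ws z = ?q \<bullet> z" for z
    using adj_proj_0_orthogonal_span[OF adj_proj_0_span, of ws w z] by (simp add: inner_simps)
  have st: "st ws (z + (t * (?q \<bullet> z)) *\<^sub>R ?q) = st (w # ws) z" for z
    unfolding st_def linear_add[OF linear_adj_proj] linear_scale[OF linear_adj_proj] qq
    by (simp add: damp_zero qz t_def algebra_simps add_divide_distrib diff_divide_distrib)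
  have IH: "(\<integral>\<^sup>+x. F x \<partial>lborel) \<le> ennreal (l ^ length ws) * (\<integral>\<^sup>+z. F (st ws z) \<partial>lborel)"
    using Cons unfolding st_def by simp
  have "(\<integral>\<^sup>+z. F (st ws z) \<partial>lborel) = ennreal (1 + t * (?q \<bullet> ?q)) * (\<integral>\<^sup>+z. F (st ws (z + (t * (?q \<bullet> z)) *\<^sub>R ?q)) \<partial>lborel)"
    using t by (subst nn_integral_lborel_rank_one[of "\<lambda>z. F (st ws z)"])
      (auto simp: mult.assoc[symmetric] ennreal_mult'[symmetric] simp del: ennreal_plus)
  also have "\<dots> \<le> ennreal l * (\<integral>\<^sup>+z. F (st (w # ws) z) \<partial>lborel)"
    unfolding st using t by (intro mult_right_mono ennreal_leI) auto
  finally have "ennreal (l ^ length ws) * (\<integral>\<^sup>+z. F (st ws z) \<partial>lborel)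
    \<le> ennreal (l ^ length ws) * (ennreal l * (\<integral>\<^sup>+z. F (st (w # ws) z) \<partial>lborel))"
    by (intro mult_left_mono) auto
  also have "\<dots> = ennreal (l ^ length (w # ws)) * (\<integral>\<^sup>+z. F (st (w # ws) z) \<partial>lborel)"
    using assms(1) by (simp add: mult.assoc[symmetric] ennreal_mult'[symmetric] mult.commute)
  finally show ?case using IH unfolding st_def by (rule order_trans[rotated])
qed simp

lemma nn_integral_lborel_scaleR:
  fixes f :: "'a::euclidean_space \<Rightarrow> ennreal"
  assumes [measurable]: "f \<in> borel_measurable borel" and t: "t > 0"
  shows "(\<integral>\<^sup>+x. f x \<partial>lborel) = ennreal (t ^ DIM('a)) * (\<integral>\<^sup>+x. f (t *\<^sub>R x) \<partial>lborel)"
proof -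
  have "(\<integral>\<^sup>+x. f x \<partial>lborel) = (\<integral>\<^sup>+x. f x \<partial>density (distr lborel borel (\<lambda>x. 0 + t *\<^sub>R x)) (\<lambda>_. ennreal (\<bar>t\<bar> ^ DIM('a))))"
    using t by (intro arg_cong[where f = "\<lambda>M. integral\<^sup>N M f"] lborel_affine) simp
  then show ?thesis
    using t by (simp add: nn_integral_density nn_integral_distr nn_integral_cmult)
qed

text \<open>Scaling by \<open>t\<close> after stretching the span by \<open>1 / t\<close> contracts
  only the complement, with Jacobian at most \<open>t ^ (CARD('n) - length ws)\<close>. The event
  becomes \<open>norm (P z) < 1\<close>, where the contraction of \<open>P z\<close> changes the
  Gaussian density by a factor of at most \<open>exp 1\<close>.\<close>

lemma emeasure_gauss_adj_proj_less:
  fixes ws :: "(real^'n) list"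
  assumes t: "0 < t" "t \<le> 1" and len: "length ws \<le> CARD('n)"
  shows "emeasure gauss {x. norm (adj_proj 0 ws x) < t} \<le> ennreal (exp 1 * t ^ (CARD('n) - length ws))"
proof -
  define P where "P = adj_proj 0 ws"
  have lin: "linear P" unfolding P_def by (rule linear_adj_proj)
  have [measurable]: "P \<in> borel_measurable borel" unfolding P_def by measurable
  define c where "c = sqrt pi ^ DIM(real^'n)"
  have c: "c > 0" by (simp add: c_def)
  define h where "h x = ennreal (exp (- (x \<bullet> x)) / c) * indicator {x. norm (P x) < t} x" for x
  have [measurable]: "h \<in> borel_measurable borel" unfolding h_def by measurable
  have PP: "P (P z) = P z" for z unfolding P_def
    by (rule adj_proj_0_unique) (auto simp: adj_proj_0_orthogonal span_zero)
  have orth: "P z \<bullet> (z - P z) = 0" for z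
    unfolding P_def by (intro adj_proj_0_orthogonal_span adj_proj_0_span)
  have hb: "h (t *\<^sub>R (P z + (1 / t) *\<^sub>R (z - P z))) \<le> ennreal (exp 1) * ennreal (exp (- (z \<bullet> z)) / c)" for z
  proof -
    define x where "x = t *\<^sub>R (P z + (1 / t) *\<^sub>R (z - P z))"
    have x: "x = t *\<^sub>R P z + (z - P z)" using t by (simp add: x_def algebra_simps)
    have Px: "P x = t *\<^sub>R P z"
      unfolding x linear_add[OF lin] linear_diff[OF lin] linear_scale[OF lin] PP by simp
    have zz: "z \<bullet> z = P z \<bullet> P z + (z - P z) \<bullet> (z - P z)"
      using orth[of z] by (simp add: inner_simps inner_commute)
    have xx: "(z - P z) \<bullet> (z - P z) \<le> x \<bullet> x"
      unfolding x using orth[of z] t by (simp add: inner_add_left inner_add_right inner_commute)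
    have "exp (- (x \<bullet> x)) / c \<le> exp 1 * (exp (- (z \<bullet> z)) / c)" if "norm (P x) < t"
    proof -
      have "norm (P z) < 1" using that t by (simp add: Px)
      then have "P z \<bullet> P z \<le> 1" by (simp add: dot_square_norm power_le_one)
      then have "exp (- (x \<bullet> x)) \<le> exp (1 - z \<bullet> z)" using xx zz by simp
      then show ?thesis using c by (simp add: exp_diff exp_minus field_simps)
    qed
    then show ?thesis
      unfolding x_def[symmetric] h_def
      by (auto simp: indicator_def ennreal_mult'[symmetric] intro!: ennreal_leI)
  qed
  have one: "(\<integral>\<^sup>+z. ennreal (exp (- (z \<bullet> z)) / c) \<partial>(lborel :: (real^'n) measure)) = 1"
    using nn_integral_gauss[of "\<lambda>_::real^'n. 1"] gauss.emeasure_space_1[where 'a = "real^'n"] by (simp add: c_def)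
  have "emeasure gauss {x. norm (P x) < t} = (\<integral>\<^sup>+x. h x \<partial>lborel)"
    using nn_integral_gauss[of "indicator {x. norm (P x) < t}"] by (simp add: h_def c_def)
  also have "\<dots> = ennreal (t ^ CARD('n)) * (\<integral>\<^sup>+x. h (t *\<^sub>R x) \<partial>lborel)"
    using nn_integral_lborel_scaleR[of h t] t by simp
  also have "(\<integral>\<^sup>+x. h (t *\<^sub>R x) \<partial>lborel) \<le> ennreal ((1 / t) ^ length ws) * (\<integral>\<^sup>+z. h (t *\<^sub>R (P z + (1 / t) *\<^sub>R (z - P z))) \<partial>lborel)"
    unfolding P_def using t by (intro nn_integral_lborel_stretch_le[of "1/t" "\<lambda>x. h (t *\<^sub>R x)"]) auto
  also have "(\<integral>\<^sup>+z. h (t *\<^sub>R (P z + (1 / t) *\<^sub>R (z - P z))) \<partial>lborel) \<le> (\<integral>\<^sup>+z. ennreal (exp 1) * ennreal (exp (- (z \<bullet> z)) / c) \<partial>(lborel :: (real^'n) measure))"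
    by (intro nn_integral_mono hb)
  also have "\<dots> = ennreal (exp 1)" by (subst nn_integral_cmult) (auto simp: one)
  finally have "emeasure gauss {x. norm (P x) < t} \<le> ennreal (t ^ CARD('n)) * (ennreal ((1 / t) ^ length ws) * ennreal (exp 1))"
    by (auto simp: mult_left_mono)
  also have "\<dots> = ennreal (exp 1 * t ^ (CARD('n) - length ws))"
    using t len by (simp add: ennreal_mult'[symmetric] power_diff power_divide)
  finally show ?thesis by (simp add: P_def)
qed

text \<open>A number between \<open>(1/2) ^ Suc n\<close> and \<open>(1/2) ^ n\<close> has inverse
  at most \<open>2 ^ Suc n\<close>. The summand 1 covers \<open>a \<ge> 1\<close>; at
  \<open>a = 0\<close> all indicators are 1 and the sum is infinite, matching the infinite
  inverse.\<close>

lemma inverse_power_le_dyadic_sum: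
  assumes "a \<ge> 0"
  shows "(1 / ennreal a) ^ s \<le> 1 + (\<Sum>n. ennreal (2 ^ (Suc n * s)) * indicator {a. a < (1/2) ^ n} a)"
proof (cases "a = 0")
  case True
  have ge1: "1 \<le> ennreal (2 ^ k)" for k
    by (metis ennreal_1 ennreal_leI one_le_numeral one_le_power)
  have "of_nat N \<le> (\<Sum>n. ennreal (2 ^ (Suc n * s)) * indicator {a. a < (1/2) ^ n} a)" for N
  proof -
    have "of_nat N = (\<Sum>n<N. (1::ennreal))" by simp
    also have "\<dots> \<le> (\<Sum>n<N. ennreal (2 ^ (Suc n * s)) * indicator {a. a < (1/2) ^ n} a)"
      by (intro sum_mono) (auto simp: True indicator_def ge1)
    also have "\<dots> \<le> (\<Sum>n. ennreal (2 ^ (Suc n * s)) * indicator {a. a < (1/2) ^ n} a)"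
      by (rule sum_le_suminf) auto
    finally show ?thesis .
  qed
  then have "(\<Sum>n. ennreal (2 ^ (Suc n * s)) * indicator {a. a < (1/2) ^ n} a) = top" (is "?S = top")
    using ennreal_Ex_less_of_nat[of ?S] leD less_top[of ?S] by blast
  then show ?thesis by simp
next
  case False
  then have a: "a > 0" using assms by simp
  have eq: "(1 / ennreal a) ^ s = ennreal ((1 / a) ^ s)"
    using a by (simp add: divide_ennreal ennreal_power flip: ennreal_1)
  show ?thesis
  proof (cases "a < 1")
    case True
    obtain n where n: "(1/2) ^ Suc n \<le> a" "a < (1/2) ^ n"
    proof -
      have "\<exists>m. (1/2::real) ^ m < a" using real_arch_pow_inv[OF a, of "1/2"] by auto
      then have ex: "\<exists>m. (1/2::real) ^ m \<le> a" using less_imp_le by blast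
      define m where "m = (LEAST m. (1/2::real) ^ m \<le> a)"
      have m: "(1/2) ^ m \<le> a" unfolding m_def using ex by (rule LeastI_ex)
      have "m \<noteq> 0" using m True by (cases m) auto
      then obtain k where k: "m = Suc k" by (cases m) auto
      have "\<not> (1/2) ^ k \<le> a" using not_less_Least[of k "\<lambda>m. (1/2::real) ^ m \<le> a"] k by (simp add: m_def)
      then show ?thesis using that m k by auto
    qed
    have "1 / a \<le> 2 ^ Suc n" using n(1) a by (simp add: field_simps power_divide)
    then have "(1 / a) ^ s \<le> (2 ^ Suc n) ^ s" using a by (intro power_mono) auto
    then have "(1 / ennreal a) ^ s \<le> ennreal (2 ^ (Suc n * s))"
      unfolding eq by (intro ennreal_leI) (simp only: power_mult)
    also have "\<dots> = (\<Sum>n\<in>{n}. ennreal (2 ^ (Suc n * s)) * indicator {a. a < (1/2) ^ n} a)"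
      using n by simp
    also have "\<dots> \<le> (\<Sum>n. ennreal (2 ^ (Suc n * s)) * indicator {a. a < (1/2) ^ n} a)"
      by (rule sum_le_suminf) auto
    finally show ?thesis by (rule order_trans) simp
  next
    case False
    then have "(1 / a) ^ s \<le> 1" by (intro power_le_one) auto
    then have "(1 / ennreal a) ^ s \<le> 1" unfolding eq by (simp add: ennreal_le_1)
    then show ?thesis by (rule order_trans) simp
  qed
qed

text \<open>The codimension is at least \<open>s + 1\<close>, so the event at level \<open>n\<close>
  has probability at most \<open>exp 1 * ((1/2) ^ n) ^ Suc s\<close>. Against the value
  \<open>2 ^ (Suc n * s)\<close> this leaves a geometric series with sum
  \<open>2 * exp 1 * 2 ^ s\<close>, independent of \<open>ws\<close>.\<close>

lemma nn_integral_gauss_inverse_adj_proj_le: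
  fixes ws :: "(real^'n) list"
  assumes len: "length ws + s < CARD('n)"
  shows "(\<integral>\<^sup>+x. (1 / ennreal (norm (adj_proj 0 ws x))) ^ s \<partial>gauss) \<le> ennreal (1 + 2 * exp 1 * 2 ^ s)"
proof -
  let ?A = "\<lambda>n. {x. norm (adj_proj 0 ws x) < (1/2) ^ n}"
  have [measurable]: "?A n \<in> sets borel" for n by measurable
  define S where "S = (\<Sum>n. ennreal (2 ^ (Suc n * s)) * emeasure gauss (?A n))"
  have "(\<integral>\<^sup>+x. (1 / ennreal (norm (adj_proj 0 ws x))) ^ s \<partial>gauss)
    \<le> (\<integral>\<^sup>+x. 1 + (\<Sum>n. ennreal (2 ^ (Suc n * s)) * indicator (?A n) x) \<partial>gauss)"
    using inverse_power_le_dyadic_sum[OF norm_ge_zero]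
    by (intro nn_integral_mono) (auto simp: indicator_def)
  also have "\<dots> = 1 + S"
    unfolding S_def using gauss.emeasure_space_1[where 'a = "real^'n"]
    by (simp add: nn_integral_add nn_integral_suminf nn_integral_cmult)
  finally have le: "(\<integral>\<^sup>+x. (1 / ennreal (norm (adj_proj 0 ws x))) ^ s \<partial>gauss) \<le> 1 + S" .
  have "S \<le> (\<Sum>n. ennreal (exp 1 * 2 ^ s * (1/2) ^ n))"
    unfolding S_def
  proof (rule suminf_le)
    fix n
    have "emeasure gauss (?A n) \<le> ennreal (exp 1 * ((1/2) ^ n) ^ (CARD('n) - length ws))"
      using len by (intro emeasure_gauss_adj_proj_less) (auto simp: power_le_one)
    also have "\<dots> \<le> ennreal (exp 1 * ((1/2) ^ n) ^ (Suc s))"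
      using len by (intro ennreal_leI mult_left_mono power_decreasing) (auto simp: power_le_one)
    finally have "ennreal (2 ^ (Suc n * s)) * emeasure gauss (?A n) \<le> ennreal (2 ^ (Suc n * s)) * ennreal (exp 1 * ((1/2) ^ n) ^ (Suc s))"
      by (intro mult_left_mono) auto
    also have "\<dots> = ennreal (exp 1 * 2 ^ s * (1/2) ^ n)"
      by (simp add: ennreal_mult'[symmetric] power_add power_mult power_divide mult_ac)
    finally show "ennreal (2 ^ (Suc n * s)) * emeasure gauss (?A n) \<le> ennreal (exp 1 * 2 ^ s * (1/2) ^ n)" .
  qed auto
  also have "(\<Sum>n. ennreal (exp 1 * 2 ^ s * (1/2) ^ n)) = ennreal (exp 1 * 2 ^ s * 2)"
  proof (rule suminf_ennreal_eq)
    show "(\<lambda>n. exp 1 * 2 ^ s * (1/2) ^ n :: real) sums (exp 1 * 2 ^ s * 2)"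
      using geometric_sums[of "1/2::real"] by (intro sums_mult) simp
  qed simp
  finally have "1 + S \<le> 1 + ennreal (exp 1 * 2 ^ s * 2)" by (rule add_left_mono)
  also have "\<dots> = ennreal (1 + 2 * exp 1 * 2 ^ s)"
    by (subst ennreal_plus) (simp_all add: mult_ac)
  finally show ?thesis using le by (rule order_trans[rotated])
qed

section \<open>The regularised sequential process\<close>

lemma one_divide_ennreal_antimono:
  assumes "x \<le> y"
  shows "1 / ennreal y \<le> 1 / ennreal x"
proof (cases "x \<le> 0")
  case True
  then show ?thesis by (simp add: ennreal_neg)
next
  case False
  then have "1 / y \<le> 1 / x" using assms by (simp add: frac_le)
  then show ?thesis using False assms by (simp add: divide_ennreal ennreal_leI flip: ennreal_1)
qed

lemma one_divide_ennreal_mult: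
  assumes "a \<ge> 0" "b \<ge> 0"
  shows "1 / ennreal (a * b) = (1 / ennreal a) * (1 / ennreal b)"
proof (cases "a = 0 \<or> b = 0")
  case True
  then show ?thesis by (auto simp: ennreal_top_mult ennreal_mult_top)
next
  case False
  then show ?thesis using assms
    by (simp add: divide_ennreal ennreal_mult'[symmetric] flip: ennreal_1)
qed

lemma borel_measurable_PiM_component:
  fixes N :: "'a::topological_space measure"
  assumes "w \<in> I" "sets N = sets borel"
  shows "(\<lambda>z. z w) \<in> borel_measurable (PiM I (\<lambda>_. N))"
  using measurable_component_singleton[OF assms(1), of "\<lambda>_. N"]
  by (simp add: measurable_cong_sets[OF refl assms(2)])

interpretation gauss_prod: product_sigma_finite "\<lambda>_::'v. gauss :: 'a::euclidean_space measure"
  by standard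

text \<open>The list \<open>vs\<close> holds the nodes in reverse order of processing, and \<open>nl v\<close> enumerates the neighbours
  of \<open>v\<close> processed before \<open>v\<close>.\<close>

fun reg_hom :: "('v \<Rightarrow> 'v list) \<Rightarrow> real \<Rightarrow> 'v list \<Rightarrow> ('v \<Rightarrow> 'a::real_inner) \<Rightarrow> 'v \<Rightarrow> 'a" where
  "reg_hom nl e [] z = (\<lambda>_. undefined)"
| "reg_hom nl e (v # vs) z = (reg_hom nl e vs z)(v := reg_proj e (map (reg_hom nl e vs z) (nl v)) (z v))"

fun hom_weight :: "('v \<Rightarrow> 'v list) \<Rightarrow> real \<Rightarrow> 'v list \<Rightarrow> ('v \<Rightarrow> 'a::real_inner) \<Rightarrow> ennreal" where
  "hom_weight nl e [] z = 1"
| "hom_weight nl e (v # vs) z = hom_weight nl e vs z * (1 / ennreal (reg_det e (map (reg_hom nl e vs z) (nl v))))"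

fun edge_kern :: "('v \<Rightarrow> 'v list) \<Rightarrow> real \<Rightarrow> 'v list \<Rightarrow> ('v \<Rightarrow> 'a::real_inner) \<Rightarrow> ennreal" where
  "edge_kern nl e [] x = 1"
| "edge_kern nl e (v # vs) x = edge_kern nl e vs x * (\<Prod>w\<leftarrow>nl v. kern e (x v) (x w))"

fun back_lists :: "('v \<Rightarrow> 'v list) \<Rightarrow> 'v list \<Rightarrow> bool" where
  "back_lists nl [] = True"
| "back_lists nl (v # vs) = (v \<notin> set vs \<and> set (nl v) \<subseteq> set vs \<and> back_lists nl vs)"

lemma reg_hom_cong: "(\<And>v. v \<in> set vs \<Longrightarrow> z v = z' v) \<Longrightarrow> reg_hom nl e vs z = reg_hom nl e vs z'"
  by (induction vs) auto

lemma hom_weight_cong: "(\<And>v. v \<in> set vs \<Longrightarrow> z v = z' v) \<Longrightarrow> hom_weight nl e vs z = hom_weight nl e vs z'"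
proof (induction vs)
  case (Cons v vs)
  then show ?case using reg_hom_cong[of vs z z' nl e] by simp
qed simp

lemma edge_kern_cong:
  "back_lists nl vs \<Longrightarrow> (\<And>v. v \<in> set vs \<Longrightarrow> x v = x' v) \<Longrightarrow> edge_kern nl e vs x = edge_kern nl e vs x'"
proof (induction vs)
  case (Cons v vs)
  then have "map (\<lambda>w. kern e (x v) (x w)) (nl v) = map (\<lambda>w. kern e (x' v) (x' w)) (nl v)" by auto
  with Cons show ?case by (metis edge_kern.simps(2) back_lists.simps(2) list.set_intros(2))
qed simp

text \<open>The empty process has value \<open>undefined\<close> so that the result is a point of
  the product space over \<open>set vs\<close>.\<close>

lemma reg_hom_extensional: "reg_hom nl e vs z \<in> extensional (set vs)"
  by (induction vs) (auto simp: extensional_def)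

lemma norm_reg_hom_le: "e \<ge> 0 \<Longrightarrow> v \<in> set vs \<Longrightarrow> norm (reg_hom nl e vs z v) \<le> norm (z v)"
  by (induction vs) (auto simp: norm_reg_proj_le)

lemma borel_measurable_reg_hom:
  fixes z :: "'b \<Rightarrow> 'v \<Rightarrow> 'a::euclidean_space"
  assumes "back_lists nl vs" "\<And>v. v \<in> set vs \<Longrightarrow> (\<lambda>\<omega>. z \<omega> v) \<in> borel_measurable M" "v \<in> set vs"
  shows "(\<lambda>\<omega>. reg_hom nl e vs (z \<omega>) v) \<in> borel_measurable M"
  using assms
proof (induction vs arbitrary: v)
  case (Cons a vs)
  show ?case
  proof (cases "v = a")
    case True
    have "(\<lambda>\<omega>. reg_proj e (map (\<lambda>w. reg_hom nl e vs (z \<omega>) w) (nl a)) (z \<omega> a)) \<in> borel_measurable M"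
      using Cons by (intro borel_measurable_reg_proj) auto
    then show ?thesis by (simp add: True)
  qed (use Cons in auto)
qed simp

lemma measurable_reg_hom:
  fixes vs :: "'v list"
  assumes "back_lists nl vs"
  shows "reg_hom nl e vs \<in> PiM (set vs) (\<lambda>_. gauss) \<rightarrow>\<^sub>M PiM (set vs) (\<lambda>_. gauss :: 'a::euclidean_space measure)"
proof -
  have "(\<lambda>z v. reg_hom nl e vs z v) \<in> PiM (set vs) (\<lambda>_. gauss) \<rightarrow>\<^sub>M PiM (set vs) (\<lambda>_. gauss :: 'a measure)"
  proof (rule measurable_PiM_single')
    fix v assume "v \<in> set vs"
    then show "(\<lambda>z. reg_hom nl e vs z v) \<in> PiM (set vs) (\<lambda>_. gauss) \<rightarrow>\<^sub>M (gauss :: 'a measure)"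
      unfolding measurable_cong_sets[OF refl sets_gauss]
      using assms by (intro borel_measurable_reg_hom) auto
  qed (use reg_hom_extensional in \<open>auto simp: PiE_def\<close>)
  then show ?thesis by simp
qed

lemma borel_measurable_hom_weight:
  fixes z :: "'b \<Rightarrow> 'v \<Rightarrow> 'a::euclidean_space"
  assumes "back_lists nl vs" "\<And>v. v \<in> set vs \<Longrightarrow> (\<lambda>\<omega>. z \<omega> v) \<in> borel_measurable M"
  shows "(\<lambda>\<omega>. hom_weight nl e vs (z \<omega>)) \<in> borel_measurable M"
  using assms
proof (induction vs)
  case (Cons a vs)
  have [measurable]: "(\<lambda>\<omega>. reg_det e (map (\<lambda>w. reg_hom nl e vs (z \<omega>) w) (nl a))) \<in> borel_measurable M"
    using Cons.prems by (intro borel_measurable_reg_det borel_measurable_reg_hom) auto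
  have [measurable]: "(\<lambda>\<omega>. hom_weight nl e vs (z \<omega>)) \<in> borel_measurable M"
    using Cons by auto
  show ?case by simp
qed simp

lemma borel_measurable_prod_list_kern:
  fixes z :: "'b \<Rightarrow> 'v \<Rightarrow> 'a::euclidean_space"
  assumes "y \<in> borel_measurable M" "\<And>w. w \<in> set ws \<Longrightarrow> (\<lambda>\<omega>. z \<omega> w) \<in> borel_measurable M"
  shows "(\<lambda>\<omega>. \<Prod>w\<leftarrow>ws. kern e (y \<omega>) (z \<omega> w)) \<in> borel_measurable M"
  using assms by (induction ws) auto

lemma borel_measurable_edge_kern:
  fixes z :: "'b \<Rightarrow> 'v \<Rightarrow> 'a::euclidean_space"
  assumes "back_lists nl vs" "\<And>v. v \<in> set vs \<Longrightarrow> (\<lambda>\<omega>. z \<omega> v) \<in> borel_measurable M"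
  shows "(\<lambda>\<omega>. edge_kern nl e vs (z \<omega>)) \<in> borel_measurable M"
  using assms
proof (induction vs)
  case (Cons a vs)
  have [measurable]: "(\<lambda>\<omega>. \<Prod>w\<leftarrow>nl a. kern e (z \<omega> a) (z \<omega> w)) \<in> borel_measurable M"
    using Cons.prems by (intro borel_measurable_prod_list_kern) auto
  have [measurable]: "(\<lambda>\<omega>. edge_kern nl e vs (z \<omega>)) \<in> borel_measurable M"
    using Cons by auto
  show ?case by simp
qed simp

text \<open>Induction on the node processed last: integrating out \<open>z v\<close> by
  \<open>nn_integral_reg_proj\<close> yields the kernels of its back edges and a determinant that
  cancels its weight. The arbitrary \<open>g\<close> lets the induction hypothesis be applied to the
  partial integral \<open>G\<close>.\<close>

lemma nn_integral_hom_weight: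
  fixes g :: "('v \<Rightarrow> real^'n) \<Rightarrow> ennreal"
  assumes e: "e > 0" and "back_lists nl vs" and "g \<in> borel_measurable (PiM (set vs) (\<lambda>_. gauss))"
  shows "(\<integral>\<^sup>+z. hom_weight nl e vs z * g (reg_hom nl e vs z) \<partial>PiM (set vs) (\<lambda>_. gauss))
    = (\<integral>\<^sup>+x. edge_kern nl e vs x * g x \<partial>PiM (set vs) (\<lambda>_. gauss))"
  using assms(2,3)
proof (induction vs arbitrary: g)
  case Nil
  then show ?case by (simp add: PiM_empty nn_integral_count_space_finite)
next
  case (Cons v vs)
  note [measurable] = Cons.prems(2)
  let ?P = "PiM (set vs) (\<lambda>_. gauss :: (real^'n) measure)"
  let ?P' = "PiM (insert v (set vs)) (\<lambda>_. gauss :: (real^'n) measure)"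
  have bl: "v \<notin> set vs" "set (nl v) \<subseteq> set vs" "back_lists nl vs" using Cons.prems by auto
  have g[measurable]: "g \<in> borel_measurable ?P'" using Cons.prems by simp
  note [measurable] = measurable_reg_hom[OF bl(3)]
  note mP = borel_measurable_PiM_component[OF _ sets_gauss]
  have W[measurable]: "(\<lambda>z. hom_weight nl e vs z) \<in> borel_measurable ?P"
    using bl by (intro borel_measurable_hom_weight mP) auto
  have K[measurable]: "(\<lambda>z. edge_kern nl e vs z) \<in> borel_measurable ?P"
    using bl by (intro borel_measurable_edge_kern mP) auto
  have Kv: "(\<lambda>(x, y). \<Prod>w\<leftarrow>nl v. kern e y (x w)) \<in> borel_measurable (?P \<Otimes>\<^sub>M gauss)"
    unfolding split_beta
  proof (rule borel_measurable_prod_list_kern)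
    show "(\<lambda>\<omega>. fst \<omega> w) \<in> borel_measurable (?P \<Otimes>\<^sub>M gauss)" if "w \<in> set (nl v)" for w
      using bl that by (intro measurable_compose[OF measurable_fst] mP) auto
  qed measurable
  define h where "h x y = (\<Prod>w\<leftarrow>nl v. kern e y (x w)) * g (x(v := y))" for x y
  have gm: "(\<lambda>(x, y). g (x(v := y))) \<in> borel_measurable (?P \<Otimes>\<^sub>M gauss)"
    using measurable_compose[OF measurable_add_dim g] by (simp add: split_beta')
  have h[measurable]: "(\<lambda>(x, y). h x y) \<in> borel_measurable (?P \<Otimes>\<^sub>M gauss)"
    using borel_measurable_times_ennreal[OF Kv gm] unfolding h_def by (simp add: split_beta')
  define G where "G x = (\<integral>\<^sup>+y. h x y \<partial>gauss)" for x
  have G[measurable]: "G \<in> borel_measurable ?P" unfolding G_def by measurable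
  have step: "(\<integral>\<^sup>+y. g (x(v := reg_proj e (map x (nl v)) y)) \<partial>gauss) * (1 / ennreal (reg_det e (map x (nl v)))) = G x"
    if x: "x \<in> space ?P" for x
  proof -
    have [measurable]: "(\<lambda>y. g (x(v := y))) \<in> borel_measurable borel"
      using measurable_Pair2[OF gm x] by (simp add: measurable_cong_sets[OF sets_gauss refl])
    have pos: "reg_det e (map x (nl v)) > 0" by (rule reg_det_pos[OF e])
    have "(\<integral>\<^sup>+y. g (x(v := reg_proj e (map x (nl v)) y)) \<partial>gauss) = ennreal (reg_det e (map x (nl v))) * G x"
      using nn_integral_reg_proj[OF e, of "\<lambda>y. g (x(v := y))" "map x (nl v)"]
      by (simp add: G_def h_def comp_def)
    moreover have "ennreal (reg_det e (map x (nl v))) * (1 / ennreal (reg_det e (map x (nl v)))) = 1"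
      using pos by (simp add: divide_ennreal ennreal_mult'[symmetric] flip: ennreal_1)
    ultimately show ?thesis by (metis mult.assoc mult.commute mult_1)
  qed
  have "(\<integral>\<^sup>+z. hom_weight nl e (v # vs) z * g (reg_hom nl e (v # vs) z) \<partial>?P')
    = (\<integral>\<^sup>+z. (\<integral>\<^sup>+y. hom_weight nl e (v # vs) (z(v := y)) * g (reg_hom nl e (v # vs) (z(v := y))) \<partial>gauss) \<partial>?P)"
  proof (rule gauss_prod.product_nn_integral_insert)
    have "(\<lambda>z. hom_weight nl e (v # vs) z) \<in> borel_measurable ?P'"
      using Cons.prems by (intro borel_measurable_hom_weight mP) auto
    moreover have "reg_hom nl e (v # vs) \<in> ?P' \<rightarrow>\<^sub>M ?P'"
      using measurable_reg_hom[OF Cons.prems(1), of e] by simp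
    ultimately show "(\<lambda>z. hom_weight nl e (v # vs) z * g (reg_hom nl e (v # vs) z)) \<in> borel_measurable ?P'"
      by measurable
  qed (use bl in auto)
  also have "\<dots> = (\<integral>\<^sup>+z. hom_weight nl e vs z * G (reg_hom nl e vs z) \<partial>?P)"
  proof (rule nn_integral_cong)
    fix z assume z: "z \<in> space ?P"
    let ?x = "reg_hom nl e vs z"
    have x: "?x \<in> space ?P" using z by (rule measurable_space[OF measurable_reg_hom[OF bl(3)]])
    have [measurable]: "(\<lambda>y. g (?x(v := y))) \<in> borel_measurable borel"
      using measurable_Pair2[OF gm x] by (simp add: measurable_cong_sets[OF sets_gauss refl])
    have "reg_hom nl e vs (z(v := y)) = ?x" "hom_weight nl e vs (z(v := y)) = hom_weight nl e vs z" for y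
      using bl by (auto intro!: reg_hom_cong hom_weight_cong)
    then have "(\<integral>\<^sup>+y. hom_weight nl e (v # vs) (z(v := y)) * g (reg_hom nl e (v # vs) (z(v := y))) \<partial>gauss)
      = (\<integral>\<^sup>+y. (hom_weight nl e vs z * (1 / ennreal (reg_det e (map ?x (nl v))))) * g (?x(v := reg_proj e (map ?x (nl v)) y)) \<partial>gauss)"
      by simp
    also have "\<dots> = (hom_weight nl e vs z * (1 / ennreal (reg_det e (map ?x (nl v))))) * (\<integral>\<^sup>+y. g (?x(v := reg_proj e (map ?x (nl v)) y)) \<partial>gauss)"
      by (rule nn_integral_cmult) measurable
    also have "\<dots> = hom_weight nl e vs z * G ?x"
      unfolding step[OF x, symmetric] by (simp only: mult.assoc mult.commute mult.left_commute)
    finally show "(\<integral>\<^sup>+y. hom_weight nl e (v # vs) (z(v := y)) * g (reg_hom nl e (v # vs) (z(v := y))) \<partial>gauss)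
      = hom_weight nl e vs z * G ?x" .
  qed
  also have "\<dots> = (\<integral>\<^sup>+x. edge_kern nl e vs x * G x \<partial>?P)"
    by (rule Cons.IH[OF bl(3) G])
  also have "\<dots> = (\<integral>\<^sup>+x. (\<integral>\<^sup>+y. edge_kern nl e (v # vs) (x(v := y)) * g (x(v := y)) \<partial>gauss) \<partial>?P)"
  proof (rule nn_integral_cong)
    fix x assume x: "x \<in> space ?P"
    have [measurable]: "(\<lambda>y. h x y) \<in> borel_measurable gauss"
      using measurable_Pair2[OF h x] by simp
    have 1: "edge_kern nl e vs (x(v := y)) = edge_kern nl e vs x" for y
      using bl by (intro edge_kern_cong) auto
    have 2: "map (\<lambda>w. kern e y ((x(v := y)) w)) (nl v) = map (\<lambda>w. kern e y (x w)) (nl v)" for y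
      using bl by auto
    have "edge_kern nl e (v # vs) (x(v := y)) * g (x(v := y)) = edge_kern nl e vs x * h x y" for y
      by (simp only: edge_kern.simps h_def fun_upd_same 1 2 mult.assoc)
    then show "edge_kern nl e vs x * G x = (\<integral>\<^sup>+y. edge_kern nl e (v # vs) (x(v := y)) * g (x(v := y)) \<partial>gauss)"
      by (simp add: G_def nn_integral_cmult del: edge_kern.simps)
  qed
  also have "\<dots> = (\<integral>\<^sup>+x. edge_kern nl e (v # vs) x * g x \<partial>?P')"
  proof (rule gauss_prod.product_nn_integral_insert[symmetric])
    have [measurable]: "(\<lambda>z. edge_kern nl e (v # vs) z) \<in> borel_measurable ?P'"
      using Cons.prems by (intro borel_measurable_edge_kern mP) auto
    show "(\<lambda>x. edge_kern nl e (v # vs) x * g x) \<in> borel_measurable ?P'"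
      by measurable
  qed (use bl in auto)
  finally show ?case by (simp only: list.set)
qed

section \<open>Passage of the weights to the limit e = 0\<close>

lemma hom_weight_nonzero: "hom_weight nl e vs z \<noteq> 0"
  by (induction vs) auto

text \<open>The points need not converge once neighbours become dependent, but then the weight is
  infinite and stays so. Convergence of the points is therefore claimed only for a finite weight,
  and the induction step uses it only there.\<close>

lemma tendsto_hom_weight:
  fixes z :: "'v \<Rightarrow> 'a::real_inner"
  assumes e: "e \<longlonglongrightarrow> 0" "\<And>n. 0 \<le> e n" "\<And>n. e n \<le> 1" and "back_lists nl vs"
  shows "(\<lambda>n. hom_weight nl (e n) vs z) \<longlonglongrightarrow> hom_weight nl 0 vs z
    \<and> (hom_weight nl 0 vs z \<noteq> top \<longrightarrow> (\<forall>v\<in>set vs. (\<lambda>n. reg_hom nl (e n) vs z v) \<longlonglongrightarrow> reg_hom nl 0 vs z v))"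
  using assms(4)
proof (induction vs)
  case (Cons v vs)
  have bl: "v \<notin> set vs" "set (nl v) \<subseteq> set vs" "back_lists nl vs" using Cons.prems by auto
  note IH = Cons.IH[OF bl(3)]
  let ?d = "\<lambda>e. reg_det e (map (reg_hom nl e vs z) (nl v))"
  show ?case
  proof (cases "hom_weight nl 0 vs z = top")
    case True
    \<comment> \<open>The new determinant stays below \<open>K\<close> for all \<open>n\<close>,
      since regularised projections do not increase norms. So the new factor is at least
      \<open>1 / K\<close> and the limit remains infinite.\<close>
    define K where "K = (\<Prod>w\<leftarrow>nl v. 1 + norm (z w))"
    have "0 < (\<Prod>w\<leftarrow>ws. 1 + norm (z w))" for ws
      by (induction ws) (auto simp: add_pos_nonneg)
    then have K: "K > 0" by (simp add: K_def)
    have mono: "(\<Prod>w\<leftarrow>ws. 1 + norm (reg_hom nl (e n) vs z w)) \<le> (\<Prod>w\<leftarrow>ws. 1 + norm (z w))"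
      if "set ws \<subseteq> set vs" for ws n
      using that
    proof (induction ws)
      case (Cons w ws)
      then show ?case
        using norm_reg_hom_le[OF e(2), of w vs nl n z]
        by (auto intro!: mult_mono prod_list_nonneg)
    qed simp
    have le: "?d (e n) \<le> K" for n
    proof -
      have "?d (e n) \<le> (\<Prod>w\<leftarrow>nl v. 1 + norm (reg_hom nl (e n) vs z w))"
        using reg_det_le[OF e(2,3), of n "map (reg_hom nl (e n) vs z) (nl v)"] by (simp add: comp_def)
      also have "\<dots> \<le> K"
        unfolding K_def using bl(2) by (rule mono)
      finally show ?thesis .
    qed
    have "(\<lambda>n. ennreal (1 / K) * hom_weight nl (e n) vs z) \<longlonglongrightarrow> ennreal (1 / K) * hom_weight nl 0 vs z"
      using IH by (intro ennreal_tendsto_cmult) auto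
    then have lim: "(\<lambda>n. ennreal (1 / K) * hom_weight nl (e n) vs z) \<longlonglongrightarrow> top"
      using K by (simp add: True ennreal_mult_top)
    have top: "hom_weight nl 0 (v # vs) z = top"
      by (simp add: True ennreal_top_mult)
    have "(\<lambda>n. hom_weight nl (e n) (v # vs) z) \<longlonglongrightarrow> top"
    proof (rule tendsto_sandwich[OF _ _ lim tendsto_const])
      have "ennreal (1 / K) \<le> 1 / ennreal (?d (e n))" for n
      proof -
        have "ennreal (1 / K) = 1 / ennreal K" using K by (simp add: divide_ennreal flip: ennreal_1)
        also have "\<dots> \<le> 1 / ennreal (?d (e n))"
          using le[of n] by (rule one_divide_ennreal_antimono)
        finally show ?thesis .
      qed
      then show "\<forall>\<^sub>F n in sequentially. ennreal (1 / K) * hom_weight nl (e n) vs z \<le> hom_weight nl (e n) (v # vs) z"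
        by (intro always_eventually) (auto simp: mult.commute[of "ennreal (1 / K)"] intro!: mult_left_mono)
    qed simp
    then show ?thesis using top by simp
  next
    case False
    have comp: "(\<lambda>n. reg_hom nl (e n) vs z w) \<longlonglongrightarrow> reg_hom nl 0 vs z w" if "w \<in> set vs" for w
      using IH False that by auto
    have "(\<lambda>n. ?d (e n)) \<longlonglongrightarrow> ?d 0"
      using bl comp by (intro tendsto_reg_det e) auto
    then have "(\<lambda>n. 1 / ennreal (?d (e n))) \<longlonglongrightarrow> 1 / ennreal (?d 0)"
      unfolding divide_ennreal_def mult_1
      by (intro continuous_on_tendsto_compose[OF continuous_on_inverse_ennreal[OF continuous_on_id, of UNIV]] tendsto_ennrealI) auto
    \<comment> \<open>The new factor may have an infinite limit; multiplication is still continuous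
      there because the old weight is never 0.\<close>
    then have "(\<lambda>n. hom_weight nl (e n) (v # vs) z) \<longlonglongrightarrow> hom_weight nl 0 (v # vs) z"
      unfolding hom_weight.simps using IH
      by (intro tendsto_mult_ennreal) (auto simp: hom_weight_nonzero)
    moreover have "(\<lambda>n. reg_hom nl (e n) (v # vs) z w) \<longlonglongrightarrow> reg_hom nl 0 (v # vs) z w"
      if "hom_weight nl 0 (v # vs) z \<noteq> top" "w \<in> set (v # vs)" for w
    proof -
      have "1 / ennreal (?d 0) \<noteq> top"
        using that(1) hom_weight_nonzero[of nl 0 vs z] by (auto simp: ennreal_mult_eq_top_iff)
      then have "?d 0 \<noteq> 0" by auto
      then have "(\<lambda>n. reg_proj (e n) (map (reg_hom nl (e n) vs z) (nl v)) (z v)) \<longlonglongrightarrow> reg_proj 0 (map (reg_hom nl 0 vs z) (nl v)) (z v)"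
        using bl comp by (intro tendsto_reg_proj e) auto
      then show ?thesis using comp that by (cases "w = v") auto
    qed
    ultimately show ?thesis by blast
  qed
qed simp

lemma nn_integral_hom_weight_0_le:
  fixes vs :: "'v list"
  assumes bl: "back_lists nl vs" and e: "\<And>e. e > 0 \<Longrightarrow> (\<integral>\<^sup>+x. edge_kern nl e vs (x::'v \<Rightarrow> real^'n) \<partial>PiM (set vs) (\<lambda>_. gauss)) \<le> B"
  shows "(\<integral>\<^sup>+z. hom_weight nl 0 vs (z::'v \<Rightarrow> real^'n) \<partial>PiM (set vs) (\<lambda>_. gauss)) \<le> B"
proof -
  define \<epsilon> where "\<epsilon> n = inverse (real (Suc n))" for n
  have \<epsilon>: "\<epsilon> \<longlonglongrightarrow> 0" "\<And>n. 0 < \<epsilon> n" "\<And>n. \<epsilon> n \<le> 1"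
    using LIMSEQ_inverse_real_of_nat by (auto simp: \<epsilon>_def[abs_def] inverse_le_1_iff)
  let ?P = "PiM (set vs) (\<lambda>_. gauss :: (real^'n) measure)"
  have "hom_weight nl 0 vs z = liminf (\<lambda>n. hom_weight nl (\<epsilon> n) vs z)" for z :: "'v \<Rightarrow> real^'n"
    using tendsto_hom_weight[OF \<epsilon>(1) less_imp_le[OF \<epsilon>(2)] \<epsilon>(3) bl, of z]
    by (intro lim_imp_Liminf[symmetric]) auto
  then have "(\<integral>\<^sup>+z. hom_weight nl 0 vs z \<partial>?P) = (\<integral>\<^sup>+z. liminf (\<lambda>n. hom_weight nl (\<epsilon> n) vs z) \<partial>?P)"
    by simp
  also have "\<dots> \<le> liminf (\<lambda>n. \<integral>\<^sup>+z. hom_weight nl (\<epsilon> n) vs z \<partial>?P)"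
  proof (rule nn_integral_liminf)
    show "(\<lambda>z. hom_weight nl (\<epsilon> n) vs z) \<in> borel_measurable ?P" for n
      by (intro borel_measurable_hom_weight bl borel_measurable_PiM_component) auto
  qed
  also have "(\<lambda>n. \<integral>\<^sup>+z. hom_weight nl (\<epsilon> n) vs z \<partial>?P) = (\<lambda>n. \<integral>\<^sup>+x. edge_kern nl (\<epsilon> n) vs x \<partial>?P)"
    using nn_integral_hom_weight[OF \<epsilon>(2) bl, of "\<lambda>_. 1"] by auto
  also have "liminf \<dots> \<le> B"
    using e[OF \<epsilon>(2)] by (intro Liminf_le) auto
  finally show ?thesis .
qed

section \<open>Finner's inequality and inverse moments of Gram determinants\<close>

text \<open>The value at \<open>top\<close> keeps \<open>ennroot p (x ^ p) = x\<close> valid for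
  infinite inverse determinants.\<close>

definition ennroot :: "nat \<Rightarrow> ennreal \<Rightarrow> ennreal" where
  "ennroot p x = (if x = top then top else ennreal (root p (enn2real x)))"

lemma ennroot_power:
  assumes "p > 0"
  shows "ennroot p (x ^ p) = x"
  using assms by (cases x rule: ennreal_cases)
    (auto simp: ennroot_def ennreal_power real_root_power_cancel power_eq_top_ennreal)

lemma ennroot_eq_0_iff: "p > 0 \<Longrightarrow> ennroot p x = 0 \<longleftrightarrow> x = 0"
  by (cases x rule: ennreal_cases) (auto simp: ennroot_def ennreal_eq_0_iff real_root_le_0_iff)

lemma ennroot_eq_top_iff: "ennroot p x = top \<longleftrightarrow> x = top"
  by (auto simp: ennroot_def)

lemma borel_measurable_ennroot[measurable (raw)]:
  assumes [measurable]: "f \<in> borel_measurable M"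
  shows "(\<lambda>x. ennroot p (f x)) \<in> borel_measurable M"
proof -
  have [measurable]: "root p \<in> borel_measurable borel"
    by (intro borel_measurable_continuous_onI continuous_intros)
  show ?thesis unfolding ennroot_def by measurable
qed

text \<open>Weighted AM-GM, with the missing weight put on the constant 1. With \<open>S\<close> the
  right-hand side, each logarithm is bounded by the tangent of \<open>ln\<close> at
  \<open>S\<close>; the same bound for the constant 1 absorbs the missing weight.\<close>

lemma weighted_prod_root_le:
  fixes a :: "'w \<Rightarrow> real"
  assumes "finite A" and a: "\<And>v. v \<in> A \<Longrightarrow> a v \<ge> 0" and p: "\<And>v. v \<in> A \<Longrightarrow> p v > 0"
    and \<sigma>: "(\<Sum>v\<in>A. 1 / real (p v)) \<le> 1"
  shows "(\<Prod>v\<in>A. root (p v) (a v)) \<le> (\<Sum>v\<in>A. a v / real (p v)) + (1 - (\<Sum>v\<in>A. 1 / real (p v)))"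
proof (cases "\<exists>v\<in>A. a v = 0")
  case True
  then have "(\<Prod>v\<in>A. root (p v) (a v)) = 0"
    using \<open>finite A\<close> p by (auto intro!: prod_zero)
  moreover have "(\<Sum>v\<in>A. a v / real (p v)) \<ge> 0" using a by (intro sum_nonneg) auto
  ultimately show ?thesis using \<sigma> by linarith
next
  case False
  then have pos: "\<And>v. v \<in> A \<Longrightarrow> a v > 0" using a by force
  define s where "s = (\<Sum>v\<in>A. 1 / real (p v))"
  define S where "S = (\<Sum>v\<in>A. a v / real (p v)) + (1 - s)"
  have S: "S > 0"
  proof (cases "A = {}")
    case False
    then have "(\<Sum>v\<in>A. a v / real (p v)) > 0"
      using \<open>finite A\<close> pos p by (intro sum_pos) auto
    then show ?thesis using \<sigma> by (simp add: S_def s_def)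
  qed (simp add: S_def s_def)
  have "(\<Sum>v\<in>A. ln (a v) / real (p v)) \<le> (\<Sum>v\<in>A. (a v / S - 1 + ln S) / real (p v))"
  proof (rule sum_mono)
    fix v assume v: "v \<in> A"
    have "ln (a v / S) \<le> a v / S - 1" using pos[OF v] S by (intro ln_le_minus_one) simp
    then show "ln (a v) / real (p v) \<le> (a v / S - 1 + ln S) / real (p v)"
      using pos[OF v] S by (intro divide_right_mono) (auto simp: ln_div)
  qed
  also have "\<dots> = (\<Sum>v\<in>A. (a v / real (p v)) / S + (ln S - 1) * (1 / real (p v)))"
    by (intro sum.cong) (auto simp: add_divide_distrib diff_divide_distrib)
  also have "\<dots> = (S - (1 - s)) / S + (ln S - 1) * s"
    by (simp only: sum.distrib sum_divide_distrib[symmetric] sum_distrib_left[symmetric]) (simp add: S_def s_def)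
  also have "\<dots> = (1 - s) * (1 - 1 / S) + s * ln S"
    using S by (simp add: field_simps)
  also have "\<dots> \<le> (1 - s) * ln S + s * ln S"
  proof -
    have "ln (1 / S) \<le> 1 / S - 1" using S by (intro ln_le_minus_one) simp
    then have "1 - 1 / S \<le> ln S" using S by (simp add: ln_div)
    then show ?thesis using \<sigma> by (intro add_right_mono mult_left_mono) (auto simp: s_def)
  qed
  also have "\<dots> = ln S" by (simp add: algebra_simps)
  finally have "exp (\<Sum>v\<in>A. ln (a v) / real (p v)) \<le> S" using S by (simp add: ln_ge_iff)
  moreover have "exp (\<Sum>v\<in>A. ln (a v) / real (p v)) = (\<Prod>v\<in>A. root (p v) (a v))"
    unfolding exp_sum[OF \<open>finite A\<close>]
    by (intro prod.cong refl) (use pos p in \<open>simp flip: ln_root\<close>)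
  ultimately show ?thesis by (simp add: S_def s_def)
qed

text \<open>Hoelder's inequality for weights of total at most 1: AM-GM is applied to each
  \<open>h v\<close> divided by its integral, and the missing weight costs nothing because the
  measure has mass 1. A vanishing integral makes the left side 0; an infinite one, when none
  vanishes, makes the right side infinite.\<close>

lemma (in prob_space) nn_integral_prod_ennroot_le:
  assumes "finite A" and p: "\<And>v. v \<in> A \<Longrightarrow> p v > 0"
    and \<sigma>: "(\<Sum>v\<in>A. 1 / real (p v)) \<le> 1"
    and [measurable]: "\<And>v. v \<in> A \<Longrightarrow> h v \<in> borel_measurable M"
  shows "(\<integral>\<^sup>+x. (\<Prod>v\<in>A. ennroot (p v) (h v x)) \<partial>M) \<le> (\<Prod>v\<in>A. ennroot (p v) (\<integral>\<^sup>+x. h v x \<partial>M))"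
proof -
  define m where "m v = (\<integral>\<^sup>+x. h v x \<partial>M)" for v
  consider (zero) v where "v \<in> A" "m v = 0"
    | (top) v where "v \<in> A" "m v = top" "\<forall>v\<in>A. m v \<noteq> 0"
    | (fin) "\<forall>v\<in>A. m v \<noteq> 0 \<and> m v \<noteq> top" by blast
  then show ?thesis
  proof cases
    case zero
    then have "AE x in M. h v x = 0"
      using nn_integral_0_iff_AE[of "h v" M] by (simp add: m_def)
    then have "AE x in M. (\<Prod>v\<in>A. ennroot (p v) (h v x)) = 0"
      by eventually_elim (use zero p \<open>finite A\<close> in \<open>auto simp: ennroot_eq_0_iff prod_zero_iff\<close>)
    then have "(\<integral>\<^sup>+x. (\<Prod>v\<in>A. ennroot (p v) (h v x)) \<partial>M) = 0"
      by (subst nn_integral_0_iff_AE) auto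
    then show ?thesis by simp
  next
    case top
    have "(\<Prod>v\<in>A. ennroot (p v) (m v)) = top"
      using top p \<open>finite A\<close> by (auto simp: ennreal_prod_eq_top ennroot_eq_0_iff ennroot_eq_top_iff)
    then show ?thesis by (simp add: m_def)
  next
    case fin
    define r where "r v = enn2real (m v)" for v
    have r: "r v > 0" "m v = ennreal (r v)" if "v \<in> A" for v
      using fin that by (auto simp: r_def enn2real_positive_iff less_top[symmetric] zero_less_iff_neq_zero)
    define c where "c = (\<Prod>v\<in>A. root (p v) (r v))"
    have c: "c > 0" unfolding c_def using r p by (intro prod_pos) auto
    define s where "s = (\<Sum>v\<in>A. 1 / real (p v))"
    have s: "s \<ge> 0" "s \<le> 1" using \<sigma> by (auto simp: s_def sum_nonneg)
    have pw: "(\<Prod>v\<in>A. ennroot (p v) (h v x)) \<le> ennreal c * ((\<Sum>v\<in>A. ennreal (1 / (r v * real (p v))) * h v x) + ennreal (1 - s))" for x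
    proof (cases "\<exists>v\<in>A. h v x = top")
      case True
      then obtain v where v: "v \<in> A" "h v x = top" by blast
      have "ennreal (1 / (r v * real (p v))) * h v x = top"
        using v r[OF v(1)] p[OF v(1)] by (simp add: ennreal_mult_top)
      then have "(\<Sum>v\<in>A. ennreal (1 / (r v * real (p v))) * h v x) = top"
        using v \<open>finite A\<close> by (metis (mono_tags, lifting) ennreal_sum_eq_top)
      then show ?thesis using c by (simp add: ennreal_mult_top)
    next
      case False
      define b where "b v = enn2real (h v x)" for v
      have b: "b v \<ge> 0" for v by (simp add: b_def)
      have h: "h v x = ennreal (b v)" if "v \<in> A" for v
        using False that by (auto simp: b_def less_top)
      have "(\<Prod>v\<in>A. ennroot (p v) (h v x)) = ennreal (\<Prod>v\<in>A. root (p v) (b v))"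
        using h p b False by (subst prod_ennreal[symmetric]) (auto intro!: prod.cong simp: ennroot_def)
      also have "(\<Prod>v\<in>A. root (p v) (b v)) = c * (\<Prod>v\<in>A. root (p v) (b v / r v))"
        unfolding c_def prod.distrib[symmetric]
        by (intro prod.cong refl) (use r p in \<open>auto simp: real_root_divide dest!: r(1)\<close>)
      also have "ennreal \<dots> \<le> ennreal (c * ((\<Sum>v\<in>A. (b v / r v) / real (p v)) + (1 - s)))"
        unfolding s_def using c b r p \<sigma> \<open>finite A\<close>
        by (intro ennreal_leI mult_left_mono weighted_prod_root_le) (auto simp: less_imp_le)
      also have "\<dots> = ennreal c * (ennreal (\<Sum>v\<in>A. (b v / r v) / real (p v)) + ennreal (1 - s))"
      proof -
        have "0 \<le> (\<Sum>v\<in>A. (b v / r v) / real (p v))"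
          using b r by (intro sum_nonneg) (auto simp: less_imp_le)
        then show ?thesis using c s by (simp only: ennreal_mult' ennreal_plus diff_ge_0_iff_ge less_imp_le)
      qed
      also have "ennreal (\<Sum>v\<in>A. (b v / r v) / real (p v)) = (\<Sum>v\<in>A. ennreal (1 / (r v * real (p v))) * h v x)"
        using b r by (subst sum_ennreal[symmetric])
          (auto intro!: sum.cong simp: h ennreal_mult'[symmetric] less_imp_le)
      finally show ?thesis .
    qed
    have "(\<integral>\<^sup>+x. (\<Prod>v\<in>A. ennroot (p v) (h v x)) \<partial>M)
      \<le> (\<integral>\<^sup>+x. ennreal c * ((\<Sum>v\<in>A. ennreal (1 / (r v * real (p v))) * h v x) + ennreal (1 - s)) \<partial>M)"
      by (intro nn_integral_mono pw)
    also have "\<dots> = ennreal c * ((\<Sum>v\<in>A. ennreal (1 / (r v * real (p v))) * m v) + ennreal (1 - s))"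
      by (simp add: nn_integral_cmult nn_integral_add nn_integral_sum m_def emeasure_space_1)
    also have "(\<Sum>v\<in>A. ennreal (1 / (r v * real (p v))) * m v) = (\<Sum>v\<in>A. ennreal (1 / real (p v)))"
      by (intro sum.cong refl) (use r p in \<open>force simp: ennreal_mult'[symmetric]\<close>)
    also have "\<dots> = ennreal s" unfolding s_def by (rule sum_ennreal) auto
    also have "ennreal s + ennreal (1 - s) = 1" using s by (simp flip: ennreal_plus)
    also have "ennreal c * 1 = (\<Prod>v\<in>A. ennroot (p v) (m v))"
      unfolding c_def mult_1_right using r p
      by (subst prod_ennreal[symmetric]) (auto intro!: prod.cong simp: ennroot_def less_imp_le)
    finally show ?thesis by (simp add: m_def)
  qed
qed

text \<open>Finner's inequality; one coordinate is integrated out at a time by Hoelder's inequality.\<close>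

lemma (in prob_space) nn_integral_PiM_prod_ennroot_le:
  fixes U :: "'v set" and H :: "'w \<Rightarrow> ('v \<Rightarrow> 'a) \<Rightarrow> ennreal"
  assumes "finite U" "finite A" and p: "\<And>v. v \<in> A \<Longrightarrow> p v > 0"
    and "\<And>u. u \<in> U \<Longrightarrow> (\<Sum>v\<in>{v\<in>A. u \<in> N v}. 1 / real (p v)) \<le> 1"
    and "\<And>v. v \<in> A \<Longrightarrow> H v \<in> borel_measurable (PiM U (\<lambda>_. M))"
    and "\<And>v u x y. v \<in> A \<Longrightarrow> u \<in> U \<Longrightarrow> u \<notin> N v \<Longrightarrow> H v (x(u := y)) = H v x"
  shows "(\<integral>\<^sup>+x. (\<Prod>v\<in>A. ennroot (p v) (H v x)) \<partial>PiM U (\<lambda>_. M))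
    \<le> (\<Prod>v\<in>A. ennroot (p v) (\<integral>\<^sup>+x. H v x \<partial>PiM U (\<lambda>_. M)))"
  using assms(1,4-)
proof (induction U arbitrary: H)
  case empty
  then show ?case by (simp add: PiM_empty nn_integral_count_space_finite)
next
  case (insert u U)
  interpret product_sigma_finite "\<lambda>_::'v. M" by standard
  let ?P = "PiM U (\<lambda>_. M)" and ?P' = "PiM (insert u U) (\<lambda>_. M)"
  note m[measurable] = insert.prems(2)
  have m2[measurable]: "(\<lambda>(x, y). H v (x(u := y))) \<in> borel_measurable (?P \<Otimes>\<^sub>M M)" if "v \<in> A" for v
    using measurable_compose[OF measurable_add_dim m[OF that]] by (simp only: split_beta')
  define H' where "H' v x = (\<integral>\<^sup>+y. H v (x(u := y)) \<partial>M)" for v x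
  have m3[measurable]: "H' v \<in> borel_measurable ?P" if "v \<in> A" for v
    using m2[OF that] unfolding H'_def by measurable
  \<comment> \<open>Only the functions in \<open>B\<close> depend on coordinate \<open>u\<close>,
    and the hypothesis at \<open>u\<close> is the weight condition for exactly these; the others
    leave the integral over \<open>u\<close> as constants.\<close>
  define B where "B = {v\<in>A. u \<in> N v}"
  have B: "B \<subseteq> A" "finite B" using \<open>finite A\<close> by (auto simp: B_def)
  have AB: "prod f A = prod f (A - B) * prod f B" for f :: "'w \<Rightarrow> ennreal"
    using prod.subset_diff[OF B(1) \<open>finite A\<close>] by simp
  have "(\<integral>\<^sup>+x. (\<Prod>v\<in>A. ennroot (p v) (H v x)) \<partial>?P')
    = (\<integral>\<^sup>+x. (\<integral>\<^sup>+y. (\<Prod>v\<in>A. ennroot (p v) (H v (x(u := y)))) \<partial>M) \<partial>?P)"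
    using insert.hyps by (intro product_nn_integral_insert) auto
  also have "\<dots> \<le> (\<integral>\<^sup>+x. (\<Prod>v\<in>A. ennroot (p v) (H' v x)) \<partial>?P)"
  proof (rule nn_integral_mono)
    fix x assume x: "x \<in> space ?P"
    have mx[measurable]: "(\<lambda>y. H v (x(u := y))) \<in> borel_measurable M" if "v \<in> A" for v
      using measurable_Pair2[OF m2[OF that] x] by simp
    have C: "H v (x(u := y)) = H' v x" if "v \<in> A - B" for v y
    proof -
      have "H v (x(u := y)) = H v x" for y
        using that insert.prems(3)[of v u x y] by (auto simp: B_def simp del: fun_upd_apply)
      then show ?thesis by (simp only: H'_def nn_integral_const emeasure_space_1 mult_1_right)
    qed
    have "(\<integral>\<^sup>+y. (\<Prod>v\<in>A. ennroot (p v) (H v (x(u := y)))) \<partial>M)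
      = (\<integral>\<^sup>+y. (\<Prod>v\<in>A-B. ennroot (p v) (H' v x)) * (\<Prod>v\<in>B. ennroot (p v) (H v (x(u := y)))) \<partial>M)"
      unfolding AB using C by (intro nn_integral_cong arg_cong2[where f = "(*)"] prod.cong) auto
    also have "\<dots> = (\<Prod>v\<in>A-B. ennroot (p v) (H' v x)) * (\<integral>\<^sup>+y. (\<Prod>v\<in>B. ennroot (p v) (H v (x(u := y)))) \<partial>M)"
      using B by (intro nn_integral_cmult borel_measurable_prod_ennreal borel_measurable_ennroot mx) auto
    also have "\<dots> \<le> (\<Prod>v\<in>A-B. ennroot (p v) (H' v x)) * (\<Prod>v\<in>B. ennroot (p v) (H' v x))"
      unfolding H'_def using B insert.prems(1)[of u] p
      by (intro mult_left_mono nn_integral_prod_ennroot_le mx) (auto simp: B_def)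
    finally show "(\<integral>\<^sup>+y. (\<Prod>v\<in>A. ennroot (p v) (H v (x(u := y)))) \<partial>M) \<le> (\<Prod>v\<in>A. ennroot (p v) (H' v x))"
      by (simp add: AB)
  qed
  also have "\<dots> \<le> (\<Prod>v\<in>A. ennroot (p v) (\<integral>\<^sup>+x. H' v x \<partial>?P))"
  proof (rule insert.IH)
    fix v w x y assume "v \<in> A" "w \<in> U" "w \<notin> N v"
    moreover have "w \<noteq> u" using \<open>w \<in> U\<close> insert.hyps by auto
    ultimately have "H v (x(w := y, u := y')) = H v (x(u := y'))" for y'
      using insert.prems(3)[of v w "x(u := y')" y] by (metis fun_upd_twist insertI2)
    then show "H' v (x(w := y)) = H' v x" by (simp only: H'_def)
  qed (use insert.prems in auto)
  also have "\<dots> = (\<Prod>v\<in>A. ennroot (p v) (\<integral>\<^sup>+x. H v x \<partial>?P'))"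
    unfolding H'_def using insert.hyps
    by (intro prod.cong refl arg_cong2[where f = ennroot] product_nn_integral_insert[symmetric]) auto
  finally show ?case .
qed

text \<open>The determinant splits into the distance of the head vector from the span of the others
  and their determinant. Integrating the head first gives a factor bounded uniformly in the others.
  These are one fewer than \<open>length is\<close>, so equality in the last hypothesis is
  allowed.\<close>

lemma nn_integral_inverse_reg_det_le:
  fixes "is" :: "'v list"
  assumes "finite U" "distinct is" "set is \<subseteq> U" "length is + s \<le> CARD('n)"
  shows "(\<integral>\<^sup>+x. (1 / ennreal (reg_det 0 (map x is))) ^ s \<partial>PiM U (\<lambda>_. gauss :: (real^'n) measure))
    \<le> ennreal (1 + 2 * exp 1 * 2 ^ s) ^ length is"
  using assms
proof (induction "is" arbitrary: U)
  case Nil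
  interpret product_prob_space "\<lambda>_::'v. gauss :: (real^'n) measure" U by standard
  show ?case by (simp add: emeasure_space_1)
next
  case (Cons i "is")
  define V where "V = U - {i}"
  have U: "U = insert i V" "i \<notin> V" "finite V" "set is \<subseteq> V" "i \<notin> set is" using Cons.prems by (auto simp: V_def)
  let ?C = "ennreal (1 + 2 * exp 1 * 2 ^ s)"
  let ?P = "PiM V (\<lambda>_. gauss :: (real^'n) measure)"
  note mP = borel_measurable_PiM_component[OF _ sets_gauss]
  have m: "(\<lambda>x. reg_det 0 (map (\<lambda>j. x j) js)) \<in> borel_measurable (PiM I (\<lambda>_. gauss :: (real^'n) measure))"
    if "set js \<subseteq> I" for js :: "'v list" and I
    using that by (intro borel_measurable_reg_det mP) auto
  have "(\<integral>\<^sup>+x. (1 / ennreal (reg_det 0 (map x (i # is)))) ^ s \<partial>PiM U (\<lambda>_. gauss :: (real^'n) measure))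
    = (\<integral>\<^sup>+x. (\<integral>\<^sup>+y. (1 / ennreal (reg_det 0 (map (x(i := y)) (i # is)))) ^ s \<partial>gauss) \<partial>?P)"
    unfolding U(1)
  proof (rule gauss_prod.product_nn_integral_insert)
    have [measurable]: "(\<lambda>x. reg_det 0 (map (\<lambda>j. x j) (i # is))) \<in> borel_measurable (PiM (insert i V) (\<lambda>_. gauss :: (real^'n) measure))"
      using U by (intro m) auto
    show "(\<lambda>x. (1 / ennreal (reg_det 0 (map x (i # is)))) ^ s) \<in> borel_measurable (PiM (insert i V) (\<lambda>_. gauss :: (real^'n) measure))"
      by measurable
  qed (use U in auto)
  also have "\<dots> \<le> (\<integral>\<^sup>+x. (1 / ennreal (reg_det 0 (map x is))) ^ s * ?C \<partial>?P)"
  proof (rule nn_integral_mono)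
    fix x :: "'v \<Rightarrow> real^'n"
    have mp: "map (x(i := y)) is = map x is" for y using U by auto
    have "(1 / ennreal (reg_det 0 (map (x(i := y)) (i # is)))) ^ s
      = (1 / ennreal (reg_det 0 (map x is))) ^ s * (1 / ennreal (norm (adj_proj 0 (map x is) y))) ^ s" for y
      unfolding list.map reg_det.simps fun_upd_same mp
      by (simp add: one_divide_ennreal_mult reg_det_nonneg norm_eq_sqrt_inner power_mult_distrib mult.commute)
    then have "(\<integral>\<^sup>+y. (1 / ennreal (reg_det 0 (map (x(i := y)) (i # is)))) ^ s \<partial>gauss)
      = (1 / ennreal (reg_det 0 (map x is))) ^ s * (\<integral>\<^sup>+y. (1 / ennreal (norm (adj_proj 0 (map x is) y))) ^ s \<partial>gauss)"
      by (simp add: nn_integral_cmult)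
    also have "\<dots> \<le> (1 / ennreal (reg_det 0 (map x is))) ^ s * ?C"
      using Cons.prems by (intro mult_left_mono nn_integral_gauss_inverse_adj_proj_le) auto
    finally show "(\<integral>\<^sup>+y. (1 / ennreal (reg_det 0 (map (x(i := y)) (i # is)))) ^ s \<partial>gauss)
      \<le> (1 / ennreal (reg_det 0 (map x is))) ^ s * ?C" .
  qed
  also have "\<dots> = (\<integral>\<^sup>+x. (1 / ennreal (reg_det 0 (map x is))) ^ s \<partial>?P) * ?C"
  proof (rule nn_integral_multc)
    note [measurable] = m[OF U(4)]
    show "(\<lambda>x. (1 / ennreal (reg_det 0 (map x is))) ^ s) \<in> borel_measurable ?P" by measurable
  qed
  also have "\<dots> \<le> ?C ^ length is * ?C"
    using Cons.prems U by (intro mult_right_mono Cons.IH) auto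
  finally show ?case by (simp add: mult.commute)
qed

section \<open>Gram determinants, and uniform points on the sphere\<close>

text \<open>The determinant over an index set of any type. The entries are arbitrary because
  replacing a single row destroys the symmetry of a Gram matrix.\<close>

definition leibniz :: "'i set \<Rightarrow> ('i \<Rightarrow> 'i \<Rightarrow> real) \<Rightarrow> real" where
  "leibniz S A = (\<Sum>\<pi> | \<pi> permutes S. of_int (sign \<pi>) * (\<Prod>i\<in>S. A i (\<pi> i)))"

text \<open>Composition with the transposition of the two rows permutes the terms and negates each,
  so the sum is its own negative.\<close>

lemma leibniz_equal_rows:
  assumes S: "finite S" "a \<in> S" "b \<in> S" "a \<noteq> b" and eq: "A a = A b"
  shows "leibniz S A = 0"
proof -
  let ?t = "Transposition.transpose a b" and ?P = "{\<pi>. \<pi> permutes S}"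
  have t: "?t permutes S" using S by (intro permutes_swap_id)
  have tm: "of_int (sign (\<pi> \<circ> ?t)) * (\<Prod>i\<in>S. A i ((\<pi> \<circ> ?t) i)) = - (of_int (sign \<pi>) * (\<Prod>i\<in>S. A i (\<pi> i)))"
    if "\<pi> permutes S" for \<pi>
  proof -
    have "sign (\<pi> \<circ> ?t) = sign \<pi> * sign ?t"
      using that t S by (intro sign_compose) (auto intro: permutation_permutes[THEN iffD2])
    then have "sign (\<pi> \<circ> ?t) = - sign \<pi>" using S by (simp add: sign_swap_id)
    moreover have "(\<Prod>i\<in>S. A i ((\<pi> \<circ> ?t) i)) = (\<Prod>i\<in>S. A i (\<pi> i))"
    proof -
      have "(\<Prod>i\<in>S. A i (\<pi> i)) = (\<Prod>i\<in>S. A (?t i) (\<pi> (?t i)))"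
        using prod.permute[OF t, of "\<lambda>i. A i (\<pi> i)"] by (simp add: comp_def)
      also have "\<dots> = (\<Prod>i\<in>S. A i ((\<pi> \<circ> ?t) i))"
        using eq by (intro prod.cong) (auto simp: Transposition.transpose_def)
      finally show ?thesis by simp
    qed
    ultimately show ?thesis by simp
  qed
  have bij: "bij_betw (\<lambda>\<pi>. \<pi> \<circ> ?t) ?P ?P"
    by (rule bij_betw_byWitness[where f' = "\<lambda>\<pi>. \<pi> \<circ> ?t"]) (auto simp: comp_assoc intro: permutes_compose[OF t])
  have "leibniz S A = (\<Sum>\<pi>\<in>?P. of_int (sign (\<pi> \<circ> ?t)) * (\<Prod>i\<in>S. A i ((\<pi> \<circ> ?t) i)))"
    unfolding leibniz_def by (rule sum.reindex_bij_betw[OF bij, symmetric])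
  also have "\<dots> = - leibniz S A"
    using tm by (simp add: leibniz_def sum_negf)
  finally show ?thesis by simp
qed

lemma leibniz_insert:
  assumes "finite S" "a \<notin> S"
  shows "leibniz (insert a S) (A(a := r)) = (\<Sum>\<pi> | \<pi> permutes insert a S. r (\<pi> a) * (of_int (sign \<pi>) * (\<Prod>i\<in>S. A i (\<pi> i))))"
proof -
  have "(\<Prod>i\<in>S. (if i = a then r else A i) (\<pi> i)) = (\<Prod>i\<in>S. A i (\<pi> i))" for \<pi>
    using assms by (intro prod.cong) auto
  then show ?thesis
    unfolding leibniz_def using assms by (intro sum.cong refl) (simp add: algebra_simps)
qed

text \<open>Only the permutations that fix \<open>a\<close> contribute, and they are the
  permutations of \<open>S\<close>.\<close>

lemma leibniz_insert_zero_row: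
  assumes "finite S" "a \<notin> S" "\<And>j. j \<in> S \<Longrightarrow> r j = 0"
  shows "leibniz (insert a S) (A(a := r)) = r a * leibniz S A"
proof -
  let ?f = "\<lambda>\<pi>. r (\<pi> a) * (of_int (sign \<pi>) * (\<Prod>i\<in>S. A i (\<pi> i)))"
  have "(\<Sum>\<pi> | \<pi> permutes insert a S. ?f \<pi>) = (\<Sum>\<pi> | \<pi> permutes S. ?f \<pi>)"
  proof (rule sum.mono_neutral_right)
    show "finite {\<pi>. \<pi> permutes insert a S}" using assms by (simp add: finite_permutations)
    show "{\<pi>. \<pi> permutes S} \<subseteq> {\<pi>. \<pi> permutes insert a S}" using permutes_subset[of _ S "insert a S"] by blast
    show "\<forall>\<pi>\<in>{\<pi>. \<pi> permutes insert a S} - {\<pi>. \<pi> permutes S}. ?f \<pi> = 0"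
    proof
      fix \<pi> assume \<pi>: "\<pi> \<in> {\<pi>. \<pi> permutes insert a S} - {\<pi>. \<pi> permutes S}"
      have "\<pi> a \<noteq> a"
      proof
        assume "\<pi> a = a"
        then have "\<pi> permutes S" using \<pi> by (auto intro!: permutes_superset[of \<pi> "insert a S" S, rotated])
        then show False using \<pi> by auto
      qed
      moreover have "\<pi> a \<in> insert a S" using \<pi> permutes_in_image[of \<pi> "insert a S" a] by auto
      ultimately show "?f \<pi> = 0" using assms by simp
    qed
  qed
  also have "\<dots> = r a * leibniz S A"
    unfolding leibniz_def sum_distrib_left
    using assms by (intro sum.cong refl) (auto simp: permutes_not_in)
  finally show ?thesis using leibniz_insert[OF assms(1,2)] by simp
qed

text \<open>The determinant \<open>R v\<close>, with row \<open>a\<close> computed from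
  \<open>v\<close>, is linear in \<open>v\<close> and vanishes on the span of the other vectors,
  where rows repeat. So \<open>x a\<close> may be replaced by \<open>q\<close> in that row, which is
  then zero off the diagonal.\<close>

lemma leibniz_gram_insert:
  fixes x :: "'i \<Rightarrow> 'a::real_inner"
  assumes "finite S" "a \<notin> S" and q: "\<And>j. j \<in> S \<Longrightarrow> q \<bullet> x j = 0" and span: "x a - q \<in> span (x ` S)"
  shows "leibniz (insert a S) (\<lambda>i j. x i \<bullet> x j) = (q \<bullet> q) * leibniz S (\<lambda>i j. x i \<bullet> x j)"
proof -
  let ?A = "\<lambda>i j. x i \<bullet> x j"
  define R where "R v = leibniz (insert a S) (?A(a := (\<lambda>j. v \<bullet> x j)))" for v
  have R: "R v = (\<Sum>\<pi> | \<pi> permutes insert a S. (v \<bullet> x (\<pi> a)) * (of_int (sign \<pi>) * (\<Prod>i\<in>S. ?A i (\<pi> i))))" for v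
    unfolding R_def by (rule leibniz_insert[OF assms(1,2)])
  have add: "R (v + w) = R v + R w" and scale: "R (c *\<^sub>R v) = c * R v" for v w c
    unfolding R by (simp_all add: inner_simps distrib_right sum.distrib sum_distrib_left mult.assoc)
  have "R v = 0" if "v \<in> span (x ` S)" for v
    using that
  proof (induction rule: span_induct_alt)
    case base
    show ?case using scale[of 0 0] by simp
  next
    case (step c u w)
    then obtain b where b: "b \<in> S" "u = x b" by auto
    have "R u = 0"
      unfolding R_def using assms(1,2) b by (intro leibniz_equal_rows[of _ a b]) auto
    then show ?case using step add scale by simp
  qed
  from this[OF span] have "R (x a) = R q" using add[of "x a - q" q] by simp
  also have "\<dots> = (q \<bullet> x a) * leibniz S ?A"
    unfolding R_def using q by (rule leibniz_insert_zero_row[OF assms(1,2)])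
  also have "q \<bullet> x a = q \<bullet> q"
  proof -
    have "orthogonal q (x a - q)"
      using q by (intro orthogonal_to_span[OF span]) (auto simp: orthogonal_def)
    then show ?thesis by (simp add: orthogonal_def inner_simps)
  qed
  also have "R (x a) = leibniz (insert a S) ?A"
    unfolding R_def by (simp add: fun_upd_idem)
  finally show ?thesis .
qed

lemma gram_Det_eq_reg_det:
  fixes x :: "'i \<Rightarrow> 'a::real_inner"
  assumes "distinct is"
  shows "gram_Det (set is) x = reg_det 0 (map x is)"
  using assms
proof (induction "is")
  case Nil
  then show ?case by (simp add: gram_Det_def)
next
  case (Cons i "is")
  let ?q = "adj_proj 0 (map x is) (x i)"
  have "leibniz (insert i (set is)) (\<lambda>i j. x i \<bullet> x j) = (?q \<bullet> ?q) * leibniz (set is) (\<lambda>i j. x i \<bullet> x j)"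
    using Cons.prems adj_proj_0_orthogonal[of _ "map x is" "x i"] adj_proj_0_span[of "x i" "map x is"]
    by (intro leibniz_gram_insert) auto
  then have "gram_Det (set (i # is)) x = sqrt (?q \<bullet> ?q) * gram_Det (set is) x"
    by (simp add: gram_Det_def leibniz_def real_sqrt_mult)
  then show ?case using Cons by simp
qed

section \<open>Normalised vectors, and the sphere compared with Gaussian space\<close>

lemma adj_proj_0_map_sgn: "adj_proj 0 (map sgn ws) = adj_proj 0 ws"
proof (intro ext adj_proj_0_unique)
  fix x w
  show "adj_proj 0 ws x \<bullet> w = 0" if "w \<in> set (map sgn ws)"
    using that by (auto simp: sgn_div_norm adj_proj_0_orthogonal)
  have "set ws \<subseteq> span (set (map sgn ws))"
  proof
    fix w assume "w \<in> set ws"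
    then have "norm w *\<^sub>R sgn w \<in> span (set (map sgn ws))"
      by (intro span_scale span_base) auto
    then show "w \<in> span (set (map sgn ws))" by (cases "w = 0") (auto simp: sgn_div_norm span_zero)
  qed
  then have "span (set ws) \<subseteq> span (set (map sgn ws))" by (rule span_minimal) simp
  then show "x - adj_proj 0 ws x \<in> span (set (map sgn ws))" using adj_proj_0_span by blast
qed

text \<open>Normalising a nonzero vector of length at most 1 does not shorten it and changes no
  span, so no Gram-Schmidt distance decreases. This bounds the weights on the sphere by those of the
  Gaussian process inside the unit ball.\<close>

lemma reg_det_0_le_map_sgn:
  assumes "\<And>w. w \<in> set ws \<Longrightarrow> norm w \<le> 1"
  shows "reg_det 0 ws \<le> reg_det 0 (map sgn ws)"
  using assms
proof (induction ws)
  case (Cons w ws)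
  have "norm (adj_proj 0 ws w) \<le> norm (adj_proj 0 ws (sgn w))"
  proof (cases "w = 0")
    case False
    have "adj_proj 0 ws (norm w *\<^sub>R sgn w) = norm w *\<^sub>R adj_proj 0 ws (sgn w)"
      by (rule linear_scale[OF linear_adj_proj])
    then have "norm (adj_proj 0 ws w) = norm w * norm (adj_proj 0 ws (sgn w))"
      using False by (simp add: sgn_div_norm)
    then show ?thesis using Cons.prems[of w] by (simp add: mult_left_le_one_le)
  qed simp
  then show ?case
    using Cons by (auto intro!: mult_mono reg_det_nonneg simp: adj_proj_0_map_sgn simp flip: norm_eq_sqrt_inner)
qed simp

lemma sgn_linear_sgn:
  fixes L :: "'a::real_normed_vector \<Rightarrow> 'b::real_normed_vector"
  assumes "linear L"
  shows "sgn (L (sgn y)) = sgn (L y)"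
  by (cases "y = 0") (simp_all add: sgn_div_norm linear_scale[OF assms] linear_0[OF assms])

lemma orth_proj_sgn_image: "orth_proj (sgn ` X) = orth_proj X"
proof -
  have "{z. \<forall>w\<in>sgn ` X. z \<bullet> w = 0} = {z. \<forall>w\<in>X. z \<bullet> w = 0}"
    by (auto simp: sgn_div_norm)
  then show ?thesis by (auto simp: orth_proj_def fun_eq_iff)
qed

text \<open>A uniform point of the sphere is the direction of a uniform point of the ball, where the
  Gaussian density is at least \<open>exp (- 1) / c\<close>. The indicator is kept because
  \<open>reg_det_0_le_map_sgn\<close> needs norms at most 1.\<close>

lemma nn_integral_unif_sphere_le:
  obtains C where "C < top" "\<And>f. f \<in> borel_measurable borel \<Longrightarrow>
    (\<integral>\<^sup>+y. f y \<partial>(unif_sphere :: (real^'n) measure)) \<le> C * (\<integral>\<^sup>+z. f (sgn z) * indicator (ball 0 1) z \<partial>gauss)"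
proof -
  have [measurable]: "sgn \<in> (borel :: (real^'n) measure) \<rightarrow>\<^sub>M borel"
    unfolding sgn_div_norm[abs_def] by measurable
  let ?B = "ball (0::real^'n) 1"
  have [measurable]: "?B \<in> sets borel" by simp
  define c where "c = sqrt pi ^ DIM(real^'n)"
  have c: "c > 0" by (simp add: c_def)
  have vol: "emeasure lborel ?B \<noteq> 0"
    using open_not_negligible[of ?B] by (auto simp: negligible_iff_emeasure0)
  define C where "C = ennreal (exp 1 * c) / emeasure lborel ?B"
  have "C < top" using vol by (simp add: C_def ennreal_divide_eq_top_iff less_top[symmetric])
  moreover have "(\<integral>\<^sup>+y. f y \<partial>(unif_sphere :: (real^'n) measure)) \<le> C * (\<integral>\<^sup>+z. f (sgn z) * indicator ?B z \<partial>gauss)"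
    if [measurable]: "f \<in> borel_measurable borel" for f
  proof -
    have "(\<integral>\<^sup>+y. f y \<partial>(unif_sphere :: (real^'n) measure)) = (\<integral>\<^sup>+z. f (sgn z) * indicator ?B z \<partial>lborel) / emeasure lborel ?B"
      unfolding unif_sphere_def by (subst nn_integral_distr) (auto simp: nn_integral_uniform_measure)
    also have "\<dots> \<le> (\<integral>\<^sup>+z. ennreal (exp 1 * c) * (ennreal (exp (- (z \<bullet> z)) / c) * (f (sgn z) * indicator ?B z)) \<partial>lborel) / emeasure lborel ?B"
    proof (intro divide_right_mono_ennreal nn_integral_mono)
      fix z :: "real^'n"
      show "f (sgn z) * indicator ?B z \<le> ennreal (exp 1 * c) * (ennreal (exp (- (z \<bullet> z)) / c) * (f (sgn z) * indicator ?B z))"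
      proof (cases "z \<in> ?B")
        case True
        then have "z \<bullet> z \<le> 1" by (simp add: dot_square_norm power_le_one)
        then have "1 \<le> exp 1 * exp (- (z \<bullet> z))" by (simp add: exp_add[symmetric])
        then have "1 \<le> (exp 1 * c) * (exp (- (z \<bullet> z)) / c)" using c by simp
        then have "ennreal 1 \<le> ennreal (exp 1 * c) * ennreal (exp (- (z \<bullet> z)) / c)"
          using c by (subst ennreal_mult'[symmetric]) (auto intro!: ennreal_leI)
        then have "1 * (f (sgn z) * indicator ?B z) \<le> (ennreal (exp 1 * c) * ennreal (exp (- (z \<bullet> z)) / c)) * (f (sgn z) * indicator ?B z)"
          by (intro mult_right_mono) auto
        then show ?thesis by (simp add: mult.assoc)
      qed simp
    qed
    also have "(\<integral>\<^sup>+z. ennreal (exp 1 * c) * (ennreal (exp (- (z \<bullet> z)) / c) * (f (sgn z) * indicator ?B z)) \<partial>lborel)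
      = ennreal (exp 1 * c) * (\<integral>\<^sup>+z. ennreal (exp (- (z \<bullet> z)) / c) * (f (sgn z) * indicator ?B z) \<partial>lborel)"
      by (rule nn_integral_cmult) measurable
    also have "(\<integral>\<^sup>+z. ennreal (exp (- (z \<bullet> z)) / c) * (f (sgn z) * indicator ?B z) \<partial>lborel) = (\<integral>\<^sup>+z. f (sgn z) * indicator ?B z \<partial>gauss)"
      unfolding c_def by (rule nn_integral_gauss[symmetric]) measurable
    also have "ennreal (exp 1 * c) * (\<integral>\<^sup>+z. f (sgn z) * indicator ?B z \<partial>gauss) / emeasure lborel ?B
      = C * (\<integral>\<^sup>+z. f (sgn z) * indicator ?B z \<partial>gauss)"
      by (simp only: C_def divide_ennreal_def mult_ac)
    finally show ?thesis .
  qed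
  ultimately show ?thesis by (rule that)
qed

lemma prob_space_unif_sphere: "prob_space (unif_sphere :: (real^'n) measure)"
proof -
  have [measurable]: "sgn \<in> (borel :: (real^'n) measure) \<rightarrow>\<^sub>M borel"
    unfolding sgn_div_norm[abs_def] by measurable
  have "prob_space (uniform_measure lborel (ball (0::real^'n) 1))"
    using open_not_negligible[of "ball (0::real^'n) 1"] emeasure_lborel_ball_finite[of "0::real^'n" 1]
    by (intro prob_space_uniform_measure) (auto simp: negligible_iff_emeasure0)
  then show ?thesis unfolding unif_sphere_def by (rule prob_space.prob_space_distr) simp
qed

lemma nn_integral_PiM_transform_le:
  fixes N :: "'a measure" and M :: "'b measure" and V :: "'v set"
  assumes N: "sigma_finite_measure N" and M: "sigma_finite_measure M"
    and T[measurable]: "T \<in> M \<rightarrow>\<^sub>M N" and k[measurable]: "k \<in> borel_measurable M"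
    and le: "\<And>f. f \<in> borel_measurable N \<Longrightarrow> (\<integral>\<^sup>+y. f y \<partial>N) \<le> C * (\<integral>\<^sup>+z. f (T z) * k z \<partial>M)"
    and "finite V" and "F \<in> borel_measurable (PiM V (\<lambda>_. N))"
  shows "(\<integral>\<^sup>+y. F y \<partial>PiM V (\<lambda>_. N)) \<le> C ^ card V * (\<integral>\<^sup>+z. F (\<lambda>v\<in>V. T (z v)) * (\<Prod>v\<in>V. k (z v)) \<partial>PiM V (\<lambda>_. M))"
  using assms(6,7)
proof (induction V arbitrary: F)
  case empty
  then show ?case by (simp add: PiM_empty nn_integral_count_space_finite restrict_def)
next
  case (insert v V)
  interpret N: sigma_finite_measure N by fact
  interpret M: sigma_finite_measure M by fact
  interpret PN: product_sigma_finite "\<lambda>_::'v. N" by standard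
  interpret PM: product_sigma_finite "\<lambda>_::'v. M" by standard
  note F[measurable] = insert.prems
  let ?N = "PiM V (\<lambda>_. N)" and ?M = "PiM V (\<lambda>_. M)"
  have F2: "(\<lambda>(x, y). F (x(v := y))) \<in> borel_measurable (?N \<Otimes>\<^sub>M N)"
    using measurable_compose[OF measurable_add_dim F] by (simp only: split_beta')
  define G where "G x = (\<integral>\<^sup>+w. F (x(v := T w)) * k w \<partial>M)" for x
  have G[measurable]: "G \<in> borel_measurable ?N"
  proof -
    have "(\<lambda>p. (fst p, T (snd p))) \<in> ?N \<Otimes>\<^sub>M M \<rightarrow>\<^sub>M ?N \<Otimes>\<^sub>M N" by measurable
    from measurable_compose[OF this F2]
    have [measurable]: "(\<lambda>p. F ((fst p)(v := T (snd p)))) \<in> borel_measurable (?N \<Otimes>\<^sub>M M)"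
      by (simp only: split_beta' fst_conv snd_conv)
    have "(\<lambda>(x, w). F (x(v := T w)) * k w) \<in> borel_measurable (?N \<Otimes>\<^sub>M M)"
      unfolding split_beta' by measurable
    then show ?thesis unfolding G_def by measurable
  qed
  have mT: "(\<lambda>z. \<lambda>u\<in>I. T (z u)) \<in> PiM I (\<lambda>_. M) \<rightarrow>\<^sub>M PiM I (\<lambda>_. N)" for I :: "'v set"
    by measurable
  have "(\<integral>\<^sup>+y. F y \<partial>PiM (insert v V) (\<lambda>_. N)) = (\<integral>\<^sup>+x. (\<integral>\<^sup>+y. F (x(v := y)) \<partial>N) \<partial>?N)"
    using insert by (intro PN.product_nn_integral_insert) auto
  also have "\<dots> \<le> (\<integral>\<^sup>+x. C * G x \<partial>?N)"
    unfolding G_def using measurable_Pair2[OF F2] by (intro nn_integral_mono le) simp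
  also have "\<dots> = C * (\<integral>\<^sup>+x. G x \<partial>?N)" by (rule nn_integral_cmult) simp
  also have "\<dots> \<le> C * (C ^ card V * (\<integral>\<^sup>+z. G (\<lambda>v\<in>V. T (z v)) * (\<Prod>v\<in>V. k (z v)) \<partial>?M))"
    by (intro mult_left_mono insert.IH) auto
  also have "(\<integral>\<^sup>+z. G (\<lambda>v\<in>V. T (z v)) * (\<Prod>v\<in>V. k (z v)) \<partial>?M)
    = (\<integral>\<^sup>+z. (\<integral>\<^sup>+w. F (\<lambda>u\<in>insert v V. T ((z(v := w)) u)) * (\<Prod>u\<in>insert v V. k ((z(v := w)) u)) \<partial>M) \<partial>?M)"
  proof (rule nn_integral_cong)
    fix z assume z: "z \<in> space ?M"
    have "(\<lambda>v\<in>V. T (z v)) \<in> space ?N" using measurable_space[OF mT z] .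
    from measurable_Pair2[OF F2 this] 
    have [measurable]: "(\<lambda>w. F ((\<lambda>v\<in>V. T (z v))(v := T w))) \<in> borel_measurable M"
      using T by (auto intro: measurable_compose)
    have 1: "(\<lambda>u\<in>insert v V. T ((z(v := w)) u)) = (\<lambda>v\<in>V. T (z v))(v := T w)" for w
      using insert.hyps by (auto simp: fun_eq_iff restrict_def)
    have 2: "(\<Prod>u\<in>insert v V. k ((z(v := w)) u)) = k w * (\<Prod>u\<in>V. k (z u))" for w
    proof -
      have "(\<Prod>u\<in>V. k ((z(v := w)) u)) = (\<Prod>u\<in>V. k (z u))"
        using insert.hyps by (intro prod.cong) auto
      then show ?thesis using insert.hyps by simp
    qed
    show "G (\<lambda>v\<in>V. T (z v)) * (\<Prod>v\<in>V. k (z v))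
      = (\<integral>\<^sup>+w. F (\<lambda>u\<in>insert v V. T ((z(v := w)) u)) * (\<Prod>u\<in>insert v V. k ((z(v := w)) u)) \<partial>M)"
      unfolding G_def 1 2 mult.assoc[symmetric] by (rule nn_integral_multc[symmetric]) measurable
  qed
  also have "\<dots> = (\<integral>\<^sup>+z. F (\<lambda>u\<in>insert v V. T (z u)) * (\<Prod>u\<in>insert v V. k (z u)) \<partial>PiM (insert v V) (\<lambda>_. M))"
  proof (rule PM.product_nn_integral_insert[symmetric])
    note [measurable] = measurable_compose[OF mT[of "insert v V"] F]
    show "(\<lambda>z. F (\<lambda>u\<in>insert v V. T (z u)) * (\<Prod>u\<in>insert v V. k (z u))) \<in> borel_measurable (PiM (insert v V) (\<lambda>_. M))"
      by measurable
  qed (use insert in auto)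
  finally have "(\<integral>\<^sup>+y. F y \<partial>PiM (insert v V) (\<lambda>_. N))
    \<le> C * (C ^ card V * (\<integral>\<^sup>+z. F (\<lambda>u\<in>insert v V. T (z u)) * (\<Prod>u\<in>insert v V. k (z u)) \<partial>PiM (insert v V) (\<lambda>_. M)))" .
  moreover have "C ^ card (insert v V) = C * C ^ card V" using insert.hyps by simp
  ultimately show ?case by (simp only: mult.assoc)
qed

section \<open>Finiteness of the density\<close>

lemma back_lists_subset: "back_lists nl vs \<Longrightarrow> u \<in> set vs \<Longrightarrow> set (nl u) \<subseteq> set vs"
  by (induction vs) auto

lemma hom_weight_eq_prod:
  assumes "back_lists nl vs"
  shows "hom_weight nl e vs z = (\<Prod>v\<in>set vs. 1 / ennreal (reg_det e (map (reg_hom nl e vs z) (nl v))))"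
  using assms
proof (induction vs)
  case (Cons v vs)
  have bl: "v \<notin> set vs" "set (nl v) \<subseteq> set vs" "back_lists nl vs" using Cons.prems by auto
  have eq: "map (reg_hom nl e (v # vs) z) (nl u) = map (reg_hom nl e vs z) (nl u)" if "u \<in> set (v # vs)" for u
    using that bl back_lists_subset[OF bl(3), of u] by auto
  have "(\<Prod>u\<in>set (v # vs). 1 / ennreal (reg_det e (map (reg_hom nl e (v # vs) z) (nl u))))
    = (\<Prod>u\<in>set (v # vs). 1 / ennreal (reg_det e (map (reg_hom nl e vs z) (nl u))))"
    by (intro prod.cong refl) (simp only: eq)
  then show ?case using Cons bl by (simp add: mult.commute del: reg_hom.simps)
qed simp

lemma edge_kern_eq_prod:
  assumes "back_lists nl vs" "\<And>v. v \<in> set vs \<Longrightarrow> distinct (nl v)"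
  shows "edge_kern nl e vs x = (\<Prod>v\<in>set vs. \<Prod>w\<in>set (nl v). kern e (x v) (x w))"
  using assms
  by (induction vs) (auto simp: prod.distinct_set_conv_list mult.commute)

lemma reg_hom_no_back_edges:
  "nl u = [] \<Longrightarrow> u \<in> set vs \<Longrightarrow> reg_hom nl e vs z u = z u"
  by (induction vs) auto

text \<open>Lists run in reverse order of processing: with \<open>ws\<close> in front, the nodes of
  \<open>us\<close> come first.\<close>

lemma back_lists_bipartite:
  assumes "distinct (ws @ us)" "\<And>w. w \<in> set ws \<Longrightarrow> set (nl w) \<subseteq> set us" "\<And>u. u \<in> set us \<Longrightarrow> nl u = []"
  shows "back_lists nl (ws @ us)"
proof -
  have "back_lists nl us" if "set us \<subseteq> U" "distinct us" "\<And>u. u \<in> U \<Longrightarrow> nl u = []" for U us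
    using that by (induction us) auto
  then have "back_lists nl us" using assms by auto
  then show ?thesis using assms(1,2) by (induction ws) auto
qed

lemma sets_unif_sphere[simp, measurable_cong]: "sets unif_sphere = sets borel"
  by (simp add: unif_sphere_def)

section \<open>The ordering as a list of nodes, and the process on the sphere\<close>

definition order_list :: "'v set \<Rightarrow> ('v \<Rightarrow> nat) \<Rightarrow> nat \<Rightarrow> 'v list" where
  "order_list V p k = rev (map (inv_into V p) [1..<Suc k])"

lemma order_list_0: "order_list V p 0 = []"
  by (simp add: order_list_def)

lemma order_list_Suc: "order_list V p (Suc k) = inv_into V p (Suc k) # order_list V p k"
  by (simp add: order_list_def)

lemma set_order_list:
  assumes p: "bij_betw p V {1..card V}" and "k \<le> card V"
  shows "set (order_list V p k) = {v \<in> V. p v \<le> k}"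
proof -
  have "inv_into V p ` {1..k} = {v \<in> V. p v \<le> k}"
  proof (intro set_eqI iffI)
    fix v assume "v \<in> inv_into V p ` {1..k}"
    then obtain i where i: "i \<in> {1..k}" "v = inv_into V p i" by blast
    have "i \<in> p ` V" using p i assms(2) by (auto simp: bij_betw_def)
    then show "v \<in> {v \<in> V. p v \<le> k}" using i by (auto simp: inv_into_into f_inv_into_f)
  next
    fix v assume v: "v \<in> {v \<in> V. p v \<le> k}"
    then have "p v \<in> {1..card V}" using p by (auto simp: bij_betw_def)
    then show "v \<in> inv_into V p ` {1..k}"
      using v p by (intro image_eqI[of _ _ "p v"]) (auto simp: bij_betw_def inv_into_f_f)
  qed
  moreover have "set (order_list V p k) = inv_into V p ` {1..k}"
    by (auto simp: order_list_def simp del: upt_Suc)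
  ultimately show ?thesis by simp
qed

lemma inv_into_order:
  assumes p: "bij_betw p V {1..card V}" and "Suc k \<le> card V"
  shows "inv_into V p (Suc k) \<in> V" "p (inv_into V p (Suc k)) = Suc k"
proof -
  have "Suc k \<in> p ` V" using p assms(2) by (auto simp: bij_betw_def)
  then show "inv_into V p (Suc k) \<in> V" "p (inv_into V p (Suc k)) = Suc k"
    by (auto simp: inv_into_into f_inv_into_f)
qed

lemma back_lists_order_list:
  assumes p: "bij_betw p V {1..card V}" and "k \<le> card V"
    and nl: "\<And>v. v \<in> V \<Longrightarrow> set (nl v) = Np E p v" and sub: "\<And>v. v \<in> V \<Longrightarrow> Np E p v \<subseteq> V"
  shows "back_lists nl (order_list V p k)"
  using assms(2)
proof (induction k)
  case (Suc k)
  note v = inv_into_order[OF p Suc.prems]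
  show ?case
    using Suc v nl[OF v(1)] sub[OF v(1)] set_order_list[OF p, of k]
    by (auto simp: order_list_Suc Np_def)
qed (simp add: order_list_0)

text \<open>Normalising at every step or only at the end gives the same directions, since the
  projection is linear and depends on the earlier vectors only up to scaling. Hence \<open>y\<close>
  and \<open>z\<close> need only agree in direction.\<close>

lemma seq_hom_eq_sgn_reg_hom:
  fixes y z :: "'v \<Rightarrow> real^'n"
  assumes p: "bij_betw p V {1..card V}" and "k \<le> card V"
    and nl: "\<And>v. v \<in> V \<Longrightarrow> set (nl v) = Np E p v" and sub: "\<And>v. v \<in> V \<Longrightarrow> Np E p v \<subseteq> V"
    and yz: "\<And>v. v \<in> V \<Longrightarrow> sgn (y v) = sgn (z v)"
    and "v \<in> set (order_list V p k)"
  shows "seq_hom V E p y k v = sgn (reg_hom nl 0 (order_list V p k) z v)"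
  using assms(2,6)
proof (induction k arbitrary: v)
  case (Suc k)
  define u where "u = inv_into V p (Suc k)"
  note u = inv_into_order[OF p Suc.prems(1), folded u_def]
  let ?x = "seq_hom V E p y k" and ?X = "reg_hom nl 0 (order_list V p k) z"
  have IH: "?x w = sgn (?X w)" if "w \<in> set (order_list V p k)" for w
    using Suc that by auto
  show ?case
  proof (cases "v = u")
    case False
    then show ?thesis using Suc.prems IH by (simp add: Let_def u_def[symmetric] order_list_Suc)
  next
    case True
    have "Np E p u \<subseteq> set (order_list V p k)"
      using set_order_list[OF p, of k] Suc.prems(1) sub[OF u(1)] u by (auto simp: Np_def)
    then have "?x ` Np E p u = sgn ` (?X ` Np E p u)"
      using IH by (force simp: image_image intro!: image_cong)
    also have "?X ` Np E p u = set (map ?X (nl u))" using nl[OF u(1)] by simp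
    finally have "orth_proj (?x ` Np E p u) = reg_proj 0 (map ?X (nl u))"
      by (simp only: orth_proj_sgn_image orth_proj_eq_reg_proj fun_eq_iff simp_thms)
    moreover have "sgn (reg_proj 0 ws (y u)) = sgn (reg_proj 0 ws (z u))" for ws
      unfolding reg_proj_0 by (metis sgn_linear_sgn[OF linear_adj_proj] yz[OF u(1)])
    ultimately show ?thesis
      by (simp add: True Let_def u_def[symmetric] order_list_Suc)
  qed
qed (simp add: order_list_0)

text \<open>Each factor is the \<open>s v\<close>-th root of its own \<open>s v\<close>-th power.
  Coordinate \<open>u\<close> enters only the factors whose list contains it, so \<open>cond\<close>
  is the weight condition of Finner's inequality.\<close>

lemma nn_integral_prod_inverse_reg_det_finite:
  fixes V W :: "'v set"
  assumes fin: "finite V" and W: "W \<subseteq> V"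
    and nl: "\<And>v. v \<in> W \<Longrightarrow> distinct (nl v) \<and> set (nl v) \<subseteq> V \<and> length (nl v) < CARD('n)"
    and cond: "\<And>u. u \<in> V \<Longrightarrow> (\<Sum>v\<in>{v\<in>W. u \<in> set (nl v)}. 1 / real (CARD('n) - length (nl v))) \<le> 1"
  shows "(\<integral>\<^sup>+z. (\<Prod>v\<in>W. 1 / ennreal (reg_det 0 (map z (nl v)))) \<partial>PiM V (\<lambda>_. gauss :: (real^'n) measure)) < top"
proof -
  let ?P = "PiM V (\<lambda>_. gauss :: (real^'n) measure)"
  define s where "s v = CARD('n) - length (nl v)" for v
  define H where "H v z = (1 / ennreal (reg_det 0 (map z (nl v)))) ^ s v" for v and z :: "'v \<Rightarrow> real^'n"
  have finW: "finite W" using fin W by (rule finite_subset[rotated])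
  have s: "s v > 0" if "v \<in> W" for v using nl[OF that] by (simp add: s_def)
  note mP = borel_measurable_PiM_component[OF _ sets_gauss]
  have "(\<integral>\<^sup>+z. (\<Prod>v\<in>W. 1 / ennreal (reg_det 0 (map z (nl v)))) \<partial>?P) = (\<integral>\<^sup>+z. (\<Prod>v\<in>W. ennroot (s v) (H v z)) \<partial>?P)"
    using s by (intro nn_integral_cong prod.cong) (auto simp: H_def ennroot_power)
  also have "\<dots> \<le> (\<Prod>v\<in>W. ennroot (s v) (\<integral>\<^sup>+z. H v z \<partial>?P))"
  proof (rule gauss.nn_integral_PiM_prod_ennroot_le[where N = "\<lambda>v. set (nl v)"])
    fix v assume v: "v \<in> W"
    have [measurable]: "(\<lambda>z. reg_det 0 (map (\<lambda>j. z j) (nl v))) \<in> borel_measurable ?P"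
      using nl[OF v] by (intro borel_measurable_reg_det mP) auto
    show "H v \<in> borel_measurable ?P" unfolding H_def by measurable
    fix u and z :: "'v \<Rightarrow> real^'n" and y assume "u \<notin> set (nl v)"
    then have "map (z(u := y)) (nl v) = map z (nl v)" by auto
    then show "H v (z(u := y)) = H v z" by (simp only: H_def)
  qed (use fin finW s cond in \<open>auto simp: s_def\<close>)
  also have "\<dots> < top"
  proof -
    have "(\<integral>\<^sup>+z. H v z \<partial>?P) \<noteq> top" if "v \<in> W" for v
    proof -
      have "(\<integral>\<^sup>+z. H v z \<partial>?P) \<le> ennreal (1 + 2 * exp 1 * 2 ^ s v) ^ length (nl v)"
        unfolding H_def using nl[OF that] fin by (intro nn_integral_inverse_reg_det_le) (auto simp: s_def)
      also have "\<dots> < top" by (subst ennreal_power) (auto simp del: ennreal_plus)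
      finally show ?thesis by simp
    qed
    then have "(\<Prod>v\<in>W. ennroot (s v) (\<integral>\<^sup>+z. H v z \<partial>?P)) \<noteq> top"
      by (auto simp: ennreal_prod_eq_top ennroot_eq_top_iff)
    then show ?thesis by (simp add: less_top)
  qed
  finally show ?thesis .
qed

text \<open>With the lists cleared outside \<open>W\<close>, the nodes there keep their Gaussian
  values, so the weights of \<open>W\<close> are functions of \<open>z\<close> itself and
  \<open>reg_det_0_le\<close> removes \<open>e\<close>.\<close>

lemma nn_integral_edge_kern_le:
  fixes V W :: "'v set"
  assumes fin: "finite V" and W: "W \<subseteq> V" and e: "e > 0"
    and nl: "\<And>v. v \<in> W \<Longrightarrow> distinct (nl v) \<and> set (nl v) \<subseteq> V - W"
  shows "(\<integral>\<^sup>+x. (\<Prod>v\<in>W. \<Prod>w\<in>set (nl v). kern e (x v) (x w)) \<partial>PiM V (\<lambda>_. gauss :: (real^'n) measure))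
    \<le> (\<integral>\<^sup>+z. (\<Prod>v\<in>W. 1 / ennreal (reg_det 0 (map z (nl v)))) \<partial>PiM V (\<lambda>_. gauss :: (real^'n) measure))"
proof -
  let ?P = "PiM V (\<lambda>_. gauss :: (real^'n) measure)"
  define nl' where "nl' v = (if v \<in> W then nl v else [])" for v
  obtain ws us where ws: "set ws = W" "distinct ws" and us: "set us = V - W" "distinct us"
    using finite_distinct_list fin W by (metis finite_Diff finite_subset)
  have V: "set (ws @ us) = V" using W ws us by auto
  have bl: "back_lists nl' (ws @ us)"
    using ws us nl by (intro back_lists_bipartite) (auto simp: nl'_def)
  have drop: "(\<Prod>v\<in>V. f v (nl' v)) = (\<Prod>v\<in>W. f v (nl v))" if "\<And>v. f v [] = 1" for f :: "'v \<Rightarrow> 'v list \<Rightarrow> ennreal"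
    using fin W that by (intro prod.mono_neutral_cong_right) (auto simp: nl'_def)
  have edge: "edge_kern nl' e (ws @ us) x = (\<Prod>v\<in>W. \<Prod>w\<in>set (nl v). kern e (x v) (x w))" for x :: "'v \<Rightarrow> real^'n"
  proof -
    have "edge_kern nl' e (ws @ us) x = (\<Prod>v\<in>V. \<Prod>w\<in>set (nl' v). kern e (x v) (x w))"
      unfolding V[symmetric] using nl by (intro edge_kern_eq_prod bl) (auto simp: nl'_def)
    also have "\<dots> = (\<Prod>v\<in>W. \<Prod>w\<in>set (nl v). kern e (x v) (x w))"
      by (rule drop[of "\<lambda>v l. \<Prod>w\<in>set l. kern e (x v) (x w)"]) simp
    finally show ?thesis .
  qed
  have weight: "hom_weight nl' e (ws @ us) z = (\<Prod>v\<in>W. 1 / ennreal (reg_det e (map z (nl v))))" for z :: "'v \<Rightarrow> real^'n"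
  proof -
    have "hom_weight nl' e (ws @ us) z = (\<Prod>v\<in>V. 1 / ennreal (reg_det e (map (reg_hom nl' e (ws @ us) z) (nl' v))))"
      unfolding V[symmetric] by (rule hom_weight_eq_prod[OF bl])
    also have "\<dots> = (\<Prod>v\<in>V. 1 / ennreal (reg_det e (map z (nl' v))))"
    proof (intro prod.cong refl)
      fix v
      have "map (reg_hom nl' e (ws @ us) z) (nl' v) = map z (nl' v)"
        using us nl by (intro map_cong refl reg_hom_no_back_edges) (auto simp: nl'_def split: if_splits)
      then show "1 / ennreal (reg_det e (map (reg_hom nl' e (ws @ us) z) (nl' v))) = 1 / ennreal (reg_det e (map z (nl' v)))"
        by (simp only:)
    qed
    also have "\<dots> = (\<Prod>v\<in>W. 1 / ennreal (reg_det e (map z (nl v))))"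
      by (rule drop[of "\<lambda>v l. 1 / ennreal (reg_det e (map z l))"]) simp
    finally show ?thesis .
  qed
  have "(\<integral>\<^sup>+x. (\<Prod>v\<in>W. \<Prod>w\<in>set (nl v). kern e (x v) (x w)) \<partial>?P) = (\<integral>\<^sup>+z. (\<Prod>v\<in>W. 1 / ennreal (reg_det e (map z (nl v)))) \<partial>?P)"
    using nn_integral_hom_weight[OF e bl, of "\<lambda>_::'v \<Rightarrow> real^'n. 1"] unfolding V edge weight by simp
  also have "\<dots> \<le> (\<integral>\<^sup>+z. (\<Prod>v\<in>W. 1 / ennreal (reg_det 0 (map z (nl v)))) \<partial>?P)"
    by (intro nn_integral_mono prod_mono_ennreal one_divide_ennreal_antimono reg_det_0_le)
  finally show ?thesis .
qed

text \<open>The sphere integral is dominated by one over Gaussian points in the unit ball, at the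
  cost of \<open>C ^ card V\<close>; there the integrand is at most \<open>K\<close> times the
  weight at \<open>e = 0\<close>, whose integral is at most \<open>B\<close> by Fatou.\<close>

lemma ortho_density_p_finite:
  fixes V :: "'v set" and E :: "'v set set"
  assumes fin: "finite V" and p: "bij_betw p V {1..card V}"
    and nl: "\<And>v. v \<in> V \<Longrightarrow> distinct (nl v) \<and> set (nl v) = Np E p v" and sub: "\<And>v. v \<in> V \<Longrightarrow> Np E p v \<subseteq> V"
    and B: "B < top" "\<And>e. e > 0 \<Longrightarrow>
      (\<integral>\<^sup>+x. (\<Prod>v\<in>V. \<Prod>w\<in>Np E p v. kern e (x v) (x w)) \<partial>PiM V (\<lambda>_. gauss :: (real^'d) measure)) \<le> B"
  shows "ortho_density_p TYPE('d::finite) V E p < top"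
proof -
  let ?S = "PiM V (\<lambda>_. unif_sphere :: (real^'d) measure)" and ?G = "PiM V (\<lambda>_. gauss :: (real^'d) measure)"
  define vs where "vs = order_list V p (card V)"
  have set_vs: "set vs = V"
    using set_order_list[OF p order_refl] p by (auto simp: vs_def bij_betw_def)
  have nl': "set (nl v) = Np E p v" if "v \<in> V" for v using nl[OF that] by simp
  have bl: "back_lists nl vs" unfolding vs_def by (rule back_lists_order_list[OF p order_refl nl' sub])
  define \<Phi> where "\<Phi> y = restrict (seq_hom V E p y (card V)) V" for y :: "'v \<Rightarrow> real^'d"
  have \<Phi>: "\<Phi> y v = sgn (reg_hom nl 0 vs z v)" if "\<And>v. v \<in> V \<Longrightarrow> sgn (y v) = sgn (z v)" "v \<in> V" for y z v
    using that set_vs unfolding \<Phi>_def vs_def by (simp add: seq_hom_eq_sgn_reg_hom[OF p order_refl nl' sub that(1)])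
  define K where "K = ennreal (sphere_area (CARD('d) - 1) powi (int (card E) - int (card V)) / sphere_area (CARD('d) - 2) ^ card E)
     * (\<Prod>v\<in>V. ennreal (sphere_area (CARD('d) - card (Np E p v) - 1)))"
  have K: "K < top" by (auto simp: K_def ennreal_mult_eq_top_iff ennreal_prod_eq_top less_top[symmetric])
  have integrand: "ortho_integrand TYPE('d) V E p x = K * (\<Prod>v\<in>V. 1 / ennreal (reg_det 0 (map x (nl v))))" for x
  proof -
    have "gram_Det (Np E p v) x = reg_det 0 (map x (nl v))" if "v \<in> V" for v
      using gram_Det_eq_reg_det[of "nl v" x] nl[OF that] by simp
    then show ?thesis
      unfolding ortho_integrand_def K_def mult.assoc prod.distrib[symmetric]
      by (intro arg_cong2[where f = "(*)"] prod.cong refl) (simp add: divide_ennreal_def)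
  qed
  have mI: "ortho_integrand TYPE('d) V E p \<in> borel_measurable (PiM V (\<lambda>_. borel))"
  proof -
    have [measurable]: "(\<lambda>x. reg_det 0 (map (\<lambda>j. x j) (nl v))) \<in> borel_measurable (PiM V (\<lambda>_. borel :: (real^'d) measure))" if "v \<in> V" for v
      using nl'[OF that] sub[OF that] by (intro borel_measurable_reg_det borel_measurable_PiM_component) auto
    have "(\<lambda>x. K * (\<Prod>v\<in>V. 1 / ennreal (reg_det 0 (map x (nl v))))) \<in> borel_measurable (PiM V (\<lambda>_. borel :: (real^'d) measure))"
      by measurable
    then show ?thesis unfolding integrand[abs_def, symmetric] by (simp add: integrand[abs_def])
  qed
  have sgn[measurable]: "sgn \<in> (borel :: (real^'d) measure) \<rightarrow>\<^sub>M borel"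
    unfolding sgn_div_norm[abs_def] by measurable
  have m\<Phi>: "\<Phi> \<in> ?S \<rightarrow>\<^sub>M PiM V (\<lambda>_. borel)"
  proof -
    have "(\<lambda>y v. \<Phi> y v) \<in> ?S \<rightarrow>\<^sub>M PiM V (\<lambda>_. borel)"
    proof (rule measurable_PiM_single')
      fix v assume v: "v \<in> V"
      have "(\<lambda>y. reg_hom nl 0 vs y v) \<in> borel_measurable ?S"
        using v set_vs by (intro borel_measurable_reg_hom bl borel_measurable_PiM_component) auto
      then have "(\<lambda>y. sgn (reg_hom nl 0 vs y v)) \<in> borel_measurable ?S"
        by (rule measurable_compose[OF _ sgn])
      then show "(\<lambda>y. \<Phi> y v) \<in> borel_measurable ?S" using \<Phi>[OF refl v] by simp
    qed (auto simp: \<Phi>_def)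
    then show ?thesis by simp
  qed
  obtain C where C: "C < top" "\<And>f. f \<in> borel_measurable borel \<Longrightarrow>
    (\<integral>\<^sup>+y. f y \<partial>(unif_sphere :: (real^'d) measure)) \<le> C * (\<integral>\<^sup>+z. f (sgn z) * indicator (ball 0 1) z \<partial>gauss)"
    using nn_integral_unif_sphere_le by blast
  interpret unif: prob_space "unif_sphere :: (real^'d) measure" by (rule prob_space_unif_sphere)
  have "ortho_density_p TYPE('d) V E p = (\<integral>\<^sup>+y. ortho_integrand TYPE('d) V E p (\<Phi> y) \<partial>?S)"
    unfolding ortho_density_p_def rho_def \<Phi>_def[symmetric] by (rule nn_integral_distr[OF m\<Phi>]) (simp add: mI)
  also have "\<dots> \<le> C ^ card V * (\<integral>\<^sup>+z. ortho_integrand TYPE('d) V E p (\<Phi> (\<lambda>v\<in>V. sgn (z v))) * (\<Prod>v\<in>V. indicator (ball 0 1) (z v)) \<partial>?G)"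
  proof (rule nn_integral_PiM_transform_le)
    show "(\<lambda>y. ortho_integrand TYPE('d) V E p (\<Phi> y)) \<in> borel_measurable ?S"
      by (rule measurable_compose[OF m\<Phi> mI])
    show "sgn \<in> gauss \<rightarrow>\<^sub>M (unif_sphere :: (real^'d) measure)"
      using sgn by (simp add: measurable_cong_sets[OF sets_gauss sets_unif_sphere])
    show "(\<integral>\<^sup>+y. f y \<partial>(unif_sphere :: (real^'d) measure)) \<le> C * (\<integral>\<^sup>+z. f (sgn z) * indicator (ball 0 1) z \<partial>gauss)"
      if "f \<in> borel_measurable unif_sphere" for f
      using that by (intro C) (simp add: measurable_cong_sets[OF sets_unif_sphere refl])
    show "indicator (ball 0 1) \<in> borel_measurable (gauss :: (real^'d) measure)"
      by (rule borel_measurable_indicator) simp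
  qed (auto intro: fin unif.sigma_finite_measure_axioms gauss.sigma_finite_measure_axioms)
  also have "(\<integral>\<^sup>+z. ortho_integrand TYPE('d) V E p (\<Phi> (\<lambda>v\<in>V. sgn (z v))) * (\<Prod>v\<in>V. indicator (ball 0 1) (z v)) \<partial>?G)
    \<le> (\<integral>\<^sup>+z. K * hom_weight nl 0 vs z \<partial>?G)"
  proof (rule nn_integral_mono)
    fix z :: "'v \<Rightarrow> real^'d"
    have sgn_sgn: "sgn (sgn x) = sgn x" for x :: "real^'d"
      by (cases "x = 0") (simp_all add: sgn_div_norm[of "sgn x"] norm_sgn)
    let ?X = "reg_hom nl 0 vs z" and ?Y = "\<Phi> (\<lambda>v\<in>V. sgn (z v))"
    show "ortho_integrand TYPE('d) V E p ?Y * (\<Prod>v\<in>V. indicator (ball 0 1) (z v)) \<le> K * hom_weight nl 0 vs z"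
    \<comment> \<open>Outside the unit balls the indicators vanish. Inside, the vectors of the
      unnormalised process have norm at most 1, so normalising them only lowers the inverse
      determinants.\<close>
    proof (cases "\<forall>v\<in>V. z v \<in> ball 0 1")
      case False
      then obtain v where "v \<in> V" "z v \<notin> ball 0 1" by blast
      then have "(\<Prod>v\<in>V. indicator (ball 0 1) (z v) :: ennreal) = 0"
        using fin by (intro prod_zero bexI[of _ v]) (simp_all add: indicator_def)
      then show ?thesis by (simp only: mult_zero_right zero_le)
    next
      case True
      have "1 / ennreal (reg_det 0 (map ?Y (nl v))) \<le> 1 / ennreal (reg_det 0 (map ?X (nl v)))" if v: "v \<in> V" for v
      proof (rule one_divide_ennreal_antimono)
        have nlV: "set (nl v) \<subseteq> V" using nl'[OF v] sub[OF v] by simp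
        have "map ?Y (nl v) = map sgn (map ?X (nl v))"
          using nlV by (auto intro!: \<Phi> simp: sgn_sgn)
        moreover have "norm w \<le> 1" if w: "w \<in> set (map ?X (nl v))" for w
        proof -
          obtain u where u: "u \<in> set (nl v)" "w = ?X u" using w by auto
          have "u \<in> V" using u nlV by auto
          then have "norm (?X u) \<le> norm (z u)" "norm (z u) < 1"
            using True set_vs by (auto intro!: norm_reg_hom_le)
          then show ?thesis using u by simp
        qed
        ultimately show "reg_det 0 (map ?X (nl v)) \<le> reg_det 0 (map ?Y (nl v))"
          by (metis reg_det_0_le_map_sgn)
      qed
      then have "(\<Prod>v\<in>V. 1 / ennreal (reg_det 0 (map ?Y (nl v)))) \<le> hom_weight nl 0 vs z"
        unfolding hom_weight_eq_prod[OF bl] set_vs by (intro prod_mono_ennreal)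
      then have "K * (\<Prod>v\<in>V. 1 / ennreal (reg_det 0 (map ?Y (nl v)))) \<le> K * hom_weight nl 0 vs z"
        by (rule mult_left_mono) simp
      moreover have "(\<Prod>v\<in>V. indicator (ball 0 1) (z v) :: ennreal) = 1"
        using True by (intro prod.neutral) auto
      ultimately show ?thesis by (simp only: integrand mult_1_right)
    qed
  qed
  also have "\<dots> = K * (\<integral>\<^sup>+z. hom_weight nl 0 vs z \<partial>?G)"
    using set_vs by (intro nn_integral_cmult borel_measurable_hom_weight bl borel_measurable_PiM_component) auto
  also have "(\<integral>\<^sup>+z. hom_weight nl 0 vs z \<partial>?G) \<le> B"
  proof -
    have eq: "edge_kern nl e vs x = (\<Prod>v\<in>V. \<Prod>w\<in>Np E p v. kern e (x v) (x w))" for e and x :: "'v \<Rightarrow> real^'d"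
      using edge_kern_eq_prod[OF bl, of e x] nl unfolding set_vs by simp
    have "(\<integral>\<^sup>+x. edge_kern nl e vs (x :: 'v \<Rightarrow> real^'d) \<partial>PiM (set vs) (\<lambda>_. gauss)) \<le> B" if "e > 0" for e
      using B(2)[OF that] unfolding set_vs eq .
    from nn_integral_hom_weight_0_le[OF bl this] show ?thesis unfolding set_vs .
  qed
  finally have "ortho_density_p TYPE('d) V E p \<le> C ^ card V * (K * B)"
    by (auto simp: mult_left_mono)
  also have "\<dots> < top" using C(1) K B(1)
    by (auto simp: ennreal_mult_eq_top_iff less_top[symmetric] power_eq_top_ennreal)
  finally show ?thesis .
qed

text \<open>\<open>degs\<close> states that the denominators in \<open>cond\<close> are positive;
  otherwise negative terms, or division by zero with value 0, could satisfy \<open>cond\<close>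
  vacuously.\<close>

theorem theorem14:
  fixes V U W :: "'v set" and E :: "'v set set"
  assumes d3: "CARD('d::finite) \<ge> 3"
    and finV: "finite V"
    and simple: "E \<subseteq> {{u, w} | u w. u \<in> V \<and> w \<in> V \<and> u \<noteq> w}"
    and cover: "U \<union> W = V" and disj: "U \<inter> W = {}"
    and bip: "\<forall>e\<in>E. \<exists>u\<in>U. \<exists>w\<in>W. e = {u, w}"
    and degs: "\<forall>u\<in>U. \<forall>v\<in>nbhd E u. degree E v < CARD('d)"
    and cond: "\<forall>u\<in>U. (\<Sum>v\<in>nbhd E u. 1 / (real CARD('d) - real (degree E v))) \<le> 1"
  shows "ortho_hom_density TYPE('d) V E < \<infinity>"
proof -
  \<comment> \<open>The ordering comes from a choice operator, so all that is known of it is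
    bijectivity; it need not list U first.\<close>
  define p where "p = (SOME p. bij_betw p V {1..card V})"
  have "\<exists>p. bij_betw p V {1..card V}"
    using ex_bij_betw_nat_finite_1[OF finV] bij_betw_inv by blast
  then have p: "bij_betw p V {1..card V}" unfolding p_def by (rule someI_ex)
  then have inj: "inj_on p V" by (simp add: bij_betw_def)
  have adj: "a \<in> V" "b \<in> V" "a \<noteq> b" "a \<in> U \<and> b \<in> W \<or> a \<in> W \<and> b \<in> U" if ab: "{a, b} \<in> E" for a b
  proof -
    show "a \<in> V" "b \<in> V" "a \<noteq> b" using subsetD[OF simple ab] by (auto simp: doubleton_eq_iff)
    obtain u w where "u \<in> U" "w \<in> W" "{a, b} = {u, w}" using bspec[OF bip ab] by (elim bexE)
    then show "a \<in> U \<and> b \<in> W \<or> a \<in> W \<and> b \<in> U" by (auto simp: doubleton_eq_iff)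
  qed
  have W: "W \<subseteq> V" and VW: "V - W = U" using cover disj by auto
  have nb: "nbhd E a \<subseteq> V" for a using adj by (auto simp: nbhd_def)
  have nbW: "nbhd E a \<subseteq> U" if "a \<in> W" for a
    using adj(4)[of a] that disj unfolding nbhd_def by blast
  have sub: "Np E p v \<subseteq> V" for v using nb by (auto simp: Np_def)
  have "\<exists>l. distinct l \<and> set l = X" if "X \<subseteq> V" for X
    using finite_distinct_list[OF finite_subset[OF that finV]] by blast
  then obtain enum where enum: "\<And>X. X \<subseteq> V \<Longrightarrow> distinct (enum X) \<and> set (enum X) = X" by metis
  have enum': "distinct (enum (nbhd E v))" "set (enum (nbhd E v)) = nbhd E v" "length (enum (nbhd E v)) = degree E v" for v
    using enum[OF nb, of v] distinct_card[of "enum (nbhd E v)"] by (auto simp: degree_def)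
  \<comment> \<open>\<open>degs\<close> reaches a node of \<open>W\<close> through a neighbour in
    \<open>U\<close>; an isolated node has degree 0.\<close>
  have deg: "degree E v < CARD('d)" if "v \<in> W" for v
  proof (cases "nbhd E v = {}")
    case False
    then obtain u where "u \<in> nbhd E v" by blast
    then have "u \<in> U" "v \<in> nbhd E u" using nbW[OF that] by (auto simp: nbhd_def insert_commute)
    then show ?thesis using degs by blast
  qed (simp add: degree_def)
  let ?B = "\<integral>\<^sup>+z. (\<Prod>v\<in>W. 1 / ennreal (reg_det 0 (map z (enum (nbhd E v))))) \<partial>PiM V (\<lambda>_. gauss :: (real^'d) measure)"
  have "ortho_density_p TYPE('d) V E p < top"
  proof (rule ortho_density_p_finite[where nl = "\<lambda>v. enum (Np E p v)" and B = ?B])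
    show "?B < top"
    proof (rule nn_integral_prod_inverse_reg_det_finite)
      fix u assume u: "u \<in> V"
      \<comment> \<open>Finner's condition at \<open>u\<close> is the hypothesis of the theorem if
        \<open>u\<close> lies in \<open>U\<close>, and an empty sum if \<open>u\<close> lies in
        \<open>W\<close>.\<close>
      have eq: "{v \<in> W. u \<in> nbhd E v} = (if u \<in> U then nbhd E u else {})"
      proof -
        have "v \<in> W \<and> u \<in> nbhd E v \<longleftrightarrow> u \<in> U \<and> v \<in> nbhd E u" for v
          using adj(4)[of u v] disj unfolding nbhd_def mem_Collect_eq insert_commute[of v u] by blast
        then show ?thesis by auto
      qed
      have "(\<Sum>v\<in>nbhd E u. 1 / real (CARD('d) - degree E v)) \<le> 1" if "u \<in> U"
        using cond degs that by (auto simp: of_nat_diff less_imp_le)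
      then show "(\<Sum>v | v \<in> W \<and> u \<in> set (enum (nbhd E v)). 1 / real (CARD('d) - length (enum (nbhd E v)))) \<le> 1"
        by (simp add: enum' eq)
    qed (use finV W nb deg enum' in auto)
    fix e :: real assume e: "e > 0"
    have "(\<Prod>v\<in>V. \<Prod>w\<in>Np E p v. kern e (x v) (x w)) = (\<Prod>v\<in>W. \<Prod>w\<in>nbhd E v. kern e (x v) (x w))"
      for x :: "'v \<Rightarrow> real^'d"
    proof -
      let ?k = "\<lambda>(v, w). kern e (x v) (x w)"
      \<comment> \<open>Both products run once over each edge, oriented from its later endpoint or
        from its endpoint in \<open>W\<close>. The witnesses reorient the pairs, and symmetry of the
        kernel makes the factors agree.\<close>
      let ?i = "\<lambda>(v, w). if p w < p v then (v, w) else (w, v)" and ?j = "\<lambda>(v, w). if v \<in> W then (v, w) else (w, v)"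
      have nW: "a \<notin> W \<Longrightarrow> b \<in> W" "a \<in> W \<Longrightarrow> b \<in> W \<Longrightarrow> False" if "{a, b} \<in> E" for a b
        using adj(4)[OF that] disj by blast+
      have ord: "p a < p b" if "{a, b} \<in> E" "\<not> p b < p a" for a b
        using that(2) adj(1-3)[OF that(1)] inj_onD[OF inj] by (meson linorder_less_linear)
      have fin: "finite (Np E p v)" "finite (nbhd E v)" for v
        using finite_subset[OF sub finV] finite_subset[OF nb finV] by auto
      have "prod ?k (SIGMA v:V. Np E p v) = prod ?k (SIGMA v:W. nbhd E v)"
      proof (rule prod.reindex_bij_witness[where i = ?i and j = ?j])
        fix a assume "a \<in> (SIGMA v:V. Np E p v)"
        then obtain v w where a: "a = (v, w)" "{v, w} \<in> E" "p w < p v"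
          by (auto simp: Np_def nbhd_def)
        then show "?i (?j a) = a" "?j a \<in> (SIGMA v:W. nbhd E v)"
          using nW[OF a(2)] by (auto simp: nbhd_def insert_commute)
        show "?k (?j a) = ?k a" by (auto simp: a kern_commute)
      next
        fix a assume "a \<in> (SIGMA v:W. nbhd E v)"
        then obtain v w where a: "a = (v, w)" "{v, w} \<in> E" "v \<in> W"
          by (auto simp: nbhd_def)
        then show "?j (?i a) = a" "?i a \<in> (SIGMA v:V. Np E p v)"
          using nW[OF a(2)] ord[OF a(2)] adj(1,2)[OF a(2)] by (auto simp: nbhd_def Np_def insert_commute)
      qed
      then show ?thesis using fin finV finite_subset[OF W finV] by (simp add: prod.Sigma)
    qed
    then show "(\<integral>\<^sup>+x. (\<Prod>v\<in>V. \<Prod>w\<in>Np E p v. kern e (x v) (x w)) \<partial>PiM V (\<lambda>_. gauss :: (real^'d) measure)) \<le> ?B"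
      using nn_integral_edge_kern_le[OF finV W e, of "\<lambda>v. enum (nbhd E v)"] nbW by (simp add: enum' VW)
  qed (use finV p sub enum in auto)
  then show ?thesis by (simp add: ortho_hom_density_def p_def)
qed

end
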